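(* Let $\pi=(d_1\le\cdots\le d_n)$ be a graphical sequence with $n\ge3$. Suppose that (a) for every integer $i$ with $1\le i<\tfrac12 n$: if $d_i\le i$ then $d_{n-i}\ge n-i$; and (b) if $n$ is even, then $d_n\ge\tfrac12n+1$. Then every realization of $\pi$ is pancyclic. Moreover, this condition is weakly optimal: if $\pi$ fails (a) for some $i$ then $\pi$ is majorized by the degree sequence of $K_i+(\overline{K_i}\cup K_{n-2i})$, which has no $n$-cycle, and if $\pi$ fails (b) then $\pi$ is majorized by the degree sequence of $K_{n/2,n/2}$, which is not pancyclic.
   Context: Graphs are finite and simple. A graphical sequence is a nondecreasing integer sequence that is the degree sequence of some graph (a realization). Majorization: $(d_i')\ge(d_i)$ iff $d_i'\ge d_i$ for all $i$. A graph on $n$ vertices is pancyclic if it contains a cycle of length $l$ for every $3\le l\le n$. $G\cup H$ is disjoint union, $G+H$ is the join, $\overline{K_i}$ is the edgeless graph on $i$ vertices. *)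

theory Defs
  imports Main
begin

definition simple_graph :: "'a set \<Rightarrow> ('a \<Rightarrow> 'a \<Rightarrow> bool) \<Rightarrow> bool" where
  "simple_graph V E \<longleftrightarrow> finite V \<and> (\<forall>u v. E u v \<longrightarrow> u \<in> V \<and> v \<in> V)
     \<and> (\<forall>u v. E u v \<longrightarrow> E v u) \<and> (\<forall>u. \<not> E u u)"

definition degree :: "'a set \<Rightarrow> ('a \<Rightarrow> 'a \<Rightarrow> bool) \<Rightarrow> 'a \<Rightarrow> nat" where
  "degree V E v = card {u \<in> V. E v u}"

text \<open>Sequences are indexed 1..n: d 1, ..., d n.\<close>
definition nondecreasing_seq :: "nat \<Rightarrow> (nat \<Rightarrow> nat) \<Rightarrow> bool" where
  "nondecreasing_seq n d \<longleftrightarrow> (\<forall>j k. 1 \<le> j \<longrightarrow> j \<le> k \<longrightarrow> k \<le> n \<longrightarrow> d j \<le> d k)"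

definition realization :: "nat \<Rightarrow> (nat \<Rightarrow> nat) \<Rightarrow> 'a set \<Rightarrow> ('a \<Rightarrow> 'a \<Rightarrow> bool) \<Rightarrow> bool" where
  "realization n d V E \<longleftrightarrow> simple_graph V E \<and> nondecreasing_seq n d \<and>
     (\<exists>f. bij_betw f {1..n} V \<and> (\<forall>j \<in> {1..n}. degree V E (f j) = d j))"

definition graphical :: "nat \<Rightarrow> (nat \<Rightarrow> nat) \<Rightarrow> bool" where
  "graphical n d \<longleftrightarrow> (\<exists>(V::nat set) E. realization n d V E)"

definition majorizes :: "nat \<Rightarrow> (nat \<Rightarrow> nat) \<Rightarrow> (nat \<Rightarrow> nat) \<Rightarrow> bool" where
  "majorizes n d' d \<longleftrightarrow> (\<forall>j \<in> {1..n}. d j \<le> d' j)"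

definition has_cycle :: "'a set \<Rightarrow> ('a \<Rightarrow> 'a \<Rightarrow> bool) \<Rightarrow> nat \<Rightarrow> bool" where
  "has_cycle V E l \<longleftrightarrow> (\<exists>xs. length xs = l \<and> distinct xs \<and> set xs \<subseteq> V \<and>
     (\<forall>j < l. E (xs ! j) (xs ! ((j + 1) mod l))))"

definition pancyclic :: "'a set \<Rightarrow> ('a \<Rightarrow> 'a \<Rightarrow> bool) \<Rightarrow> bool" where
  "pancyclic V E \<longleftrightarrow> (\<forall>l. 3 \<le> l \<and> l \<le> card V \<longrightarrow> has_cycle V E l)"

text \<open>K_i + (complement K_i \<union> K_{n-2i}) on vertices {0..<n}:
 0..<i form K_i, i..<2i form the edgeless graph, 2i..<n form K_{n-2i}.\<close>
definition join_graph :: "nat \<Rightarrow> nat \<Rightarrow> nat \<Rightarrow> nat \<Rightarrow> bool" where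
  "join_graph n i u v \<longleftrightarrow> u < n \<and> v < n \<and> u \<noteq> v \<and>
     (u < i \<or> v < i \<or> (2 * i \<le> u \<and> 2 * i \<le> v))"

definition bip_graph :: "nat \<Rightarrow> nat \<Rightarrow> nat \<Rightarrow> bool" where
  "bip_graph n u v \<longleftrightarrow> u < n \<and> v < n \<and> ((u < n div 2) \<noteq> (v < n div 2))"

end

theory Submission
  imports Defs
begin

text \<open>
  By Chvatal's theorem a realization has a Hamiltonian cycle \<open>v\<^sub>0, \<dots>, v\<^sub>n\<^sub>-\<^sub>1\<close>. If two
  consecutive vertices of such a cycle have degree sum at least \<open>n + 1\<close>, counting chords at these two
  vertices gives cycles of all lengths. For odd \<open>n\<close> the hypothesis produces such a pair.

  Let \<open>n\<close> be even, and let all consecutive degree sums be at most \<open>n\<close>. Call a vertex high, medium or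
  low if its degree exceeds, equals or is less than \<open>n / 2\<close>. If there are at least \<open>n / 2 - 1\<close> low
  vertices, then high and low vertices alternate on the cycle; deleting a low vertex leaves a graph
  with a Hamiltonian cycle of odd length \<open>n - 1\<close> on which two high vertices are consecutive, so the
  first case applies to it. Otherwise there are two consecutive medium vertices, and we follow Schmeichel
  and Hakimi: if a cycle length \<open>l \<le> n - 2\<close> is missing, the chord count is tight and forces the
  two vertices to be joined to alternate vertices of the cycle, as in a balanced complete bipartite
  graph. A high vertex then has a neighbour at even distance on the cycle, and this chord creates
  cycles of every length. If \<open>n - 1\<close> is missing, the same pattern arises unless every pair of
  consecutive medium vertices is followed by two low ones, which is impossible because fewer than
  half of the vertices are low.
\<close>

section \<open>Chord patterns at two consecutive vertices\<close>

text \<open>Here \<open>\<alpha> s\<close> says that \<open>v\<^sub>0\<close> is adjacent to \<open>v\<^sub>s\<^sub>+\<^sub>1\<close>, and \<open>\<beta> p\<close> that \<open>v\<^sub>n\<^sub>-\<^sub>1\<close> is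
  adjacent to \<open>v\<^sub>p\<close>, with \<open>N = n - 2\<close>. The cycle length \<open>m + 2\<close> is missing. \<open>T1\<close> and \<open>T2\<close> are
  the tight chord count; each other assumption excludes one shape of cycle of length \<open>m + 2\<close>.\<close>

locale chord_pattern =
  fixes N m k :: nat and \<alpha> \<beta> :: "nat \<Rightarrow> bool"
  assumes N_eq: "N = m + k" and m_pos: "1 \<le> m" and k_ge: "2 \<le> k"
    and ends: "\<alpha> 0" "\<alpha> N" "\<beta> 0" "\<beta> N"
    and T1: "\<And>s. s \<le> k \<Longrightarrow> \<alpha> s \<longleftrightarrow> \<not> \<beta> (s + m)"
    and T2: "\<And>s. s \<le> m \<Longrightarrow> \<beta> s \<longleftrightarrow> \<not> \<alpha> (s + k)"
    and F1: "\<And>s. s \<le> k \<Longrightarrow> \<alpha> s \<Longrightarrow> \<not> \<alpha> (s + m)"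
    and F2: "\<And>s. s \<le> k \<Longrightarrow> \<beta> s \<Longrightarrow> \<not> \<beta> (s + m)"
    and A: "\<And>p q s. p \<le> s \<Longrightarrow> s < q \<Longrightarrow> q \<le> N \<Longrightarrow> p + q = m + s \<Longrightarrow> \<beta> p \<Longrightarrow> \<alpha> s \<Longrightarrow> \<not> \<beta> q"
    and B: "\<And>p q s. q < s \<Longrightarrow> s \<le> p \<Longrightarrow> p \<le> N \<Longrightarrow> p + q = k + s \<Longrightarrow> \<alpha> p \<Longrightarrow> \<alpha> q \<Longrightarrow> \<not> \<beta> s"
    and C1: "\<And>x. x < m \<Longrightarrow> \<beta> 1 \<Longrightarrow> \<alpha> x \<Longrightarrow> \<not> \<alpha> (k + x + 1)"
    and C2: "\<And>x. x < m \<Longrightarrow> \<alpha> (N - 1) \<Longrightarrow> \<beta> (N - x) \<Longrightarrow> \<not> \<beta> (m - x - 1)"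
begin

text \<open>Reversing the cycle exchanges its two ends, hence \<open>\<alpha> s\<close> with
  \<open>\<beta> (N - s)\<close>. The pairs \<open>F1\<close>/\<open>F2\<close>,
  \<open>A\<close>/\<open>B\<close> and \<open>C1\<close>/\<open>C2\<close> swap, while
  \<open>T1\<close> and \<open>T2\<close> each map to themselves, so every fact about one end also
  holds at the other.\<close>

lemma mirror: "chord_pattern N m k (\<lambda>s. \<beta> (N - s)) (\<lambda>s. \<alpha> (N - s))"
proof
  show "N = m + k" "1 \<le> m" "2 \<le> k" by (fact N_eq m_pos k_ge)+
  show "\<beta> (N - 0)" "\<beta> (N - N)" "\<alpha> (N - 0)" "\<alpha> (N - N)" using ends by auto
  show "\<beta> (N - s) \<longleftrightarrow> \<not> \<alpha> (N - (s + m))" if "s \<le> k" for s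
    using T1[of "k - s"] that by (simp add: N_eq add.commute)
  show "\<alpha> (N - s) \<longleftrightarrow> \<not> \<beta> (N - (s + k))" if "s \<le> m" for s
    using T2[of "m - s"] that by (simp add: N_eq)
  show "\<not> \<beta> (N - (s + m))" if "s \<le> k" "\<beta> (N - s)" for s
    using F2[of "k - s"] that by (auto simp add: N_eq add.commute)
  show "\<not> \<alpha> (N - (s + m))" if "s \<le> k" "\<alpha> (N - s)" for s
    using F1[of "k - s"] that by (auto simp add: N_eq add.commute)
  show "\<not> \<alpha> (N - q)" if "p \<le> s" "s < q" "q \<le> N" "p + q = m + s" "\<alpha> (N - p)" "\<beta> (N - s)" for p q s
  proof
    assume "\<alpha> (N - q)"
    then have "\<not> \<beta> (N - s)" by (intro B[of "N - q" "N - s" "N - p"]) (use that N_eq in auto)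
    then show False using that by simp
  qed
  show "\<not> \<alpha> (N - s)" if "q < s" "s \<le> p" "p \<le> N" "p + q = k + s" "\<beta> (N - p)" "\<beta> (N - q)" for p q s
  proof
    assume "\<alpha> (N - s)"
    then have "\<not> \<beta> (N - q)" by (intro A[of "N - p" "N - s" "N - q"]) (use that N_eq in auto)
    then show False using that by simp
  qed
  show "\<not> \<beta> (N - (k + x + 1))" if "x < m" "\<alpha> (N - 1)" "\<beta> (N - x)" for x
    using C2[of x] that by (auto simp: N_eq)
  show "\<not> \<alpha> (N - (m - x - 1))" if "x < m" "\<beta> (N - (N - 1))" "\<alpha> (N - (N - x))" for x
  proof -
    have "N - (N - 1) = 1" "N - (N - x) = x" "N - (m - x - 1) = k + x + 1"
      using that(1) N_eq m_pos by auto
    then show ?thesis using C1[OF that(1)] that by simp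
  qed
qed

lemma \<beta>_imp_\<alpha>: "s \<le> k \<Longrightarrow> \<beta> s \<Longrightarrow> \<alpha> s"
  using T1 F2 by blast

lemma \<alpha>_imp_\<beta>: assumes "m \<le> s" "s \<le> N" "\<alpha> s" shows "\<beta> s"
proof -
  have "s - m \<le> k" "s - m + m = s" using assms N_eq by auto
  then show ?thesis using F1[of "s - m"] T1[of "s - m"] assms by auto
qed

lemma not_at_m: "\<not> \<alpha> m" "\<not> \<beta> m"
  using F1[of 0] F2[of 0] ends by auto

lemma not_at_k: "\<not> \<alpha> k" "\<not> \<beta> k"
  using F1[of k] F2[of k] ends N_eq by (auto simp: add.commute)

text \<open>Otherwise \<open>C1\<close> and \<open>T2\<close> carry \<beta> from each label to the
  next, from \<open>0\<close> up to \<open>min m k\<close>, although \<beta> fails at both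
  \<open>m\<close> and \<open>k\<close>.\<close>

lemma not_\<beta>_1: "\<not> \<beta> 1"
proof
  assume b1: "\<beta> 1"
  have "\<beta> x" if "x \<le> min m k" for x
    using that
  proof (induction x)
    case 0
    show ?case by (fact ends)
  next
    case (Suc x)
    then have "\<alpha> x" using \<beta>_imp_\<alpha> by simp
    then have "\<not> \<alpha> (k + x + 1)" using C1 b1 Suc.prems by simp
    then show ?case using T2[of "Suc x"] Suc.prems by (simp add: add.commute)
  qed
  from this[of "min m k"] show False using not_at_m not_at_k by (simp add: min_def split: if_splits)
qed

lemma not_\<alpha>_pred_N: "\<not> \<alpha> (N - 1)"
proof -
  interpret M: chord_pattern N m k "\<lambda>s. \<beta> (N - s)" "\<lambda>s. \<alpha> (N - s)" by (rule mirror)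
  show ?thesis by (rule M.not_\<beta>_1)
qed

lemma \<beta>_pred_m: "\<beta> (m - 1)"
  using T2[of "m - 1"] not_\<alpha>_pred_N m_pos N_eq by simp

text \<open>Otherwise \<open>B\<close> with \<open>q = 1\<close> and \<open>T2\<close> carry \<beta>
  downwards from \<open>m - 1\<close> to \<open>1\<close>, where it fails. If \<open>m = 1\<close>,
  the assumption itself contradicts \<open>not_at_m\<close>.\<close>

lemma not_\<alpha>_1: "\<not> \<alpha> 1"
proof
  assume a1: "\<alpha> 1"
  have step: "\<beta> s" if "1 \<le> s" "s \<le> m" "\<beta> (Suc s)" for s
    using B[of 1 "Suc s" "k + s"] a1 that T2[of s] k_ge N_eq by (auto simp: add.commute)
  have "\<beta> (m - 1 - j)" if "j < m - 1" for j
    using that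
  proof (induction j)
    case 0
    then show ?case using \<beta>_pred_m by simp
  next
    case (Suc j)
    then show ?case using step[of "m - 1 - Suc j"] by (simp add: Suc_diff_Suc)
  qed
  from this[of "m - 2"] have "m \<noteq> 1 \<Longrightarrow> \<beta> 1" using m_pos
    by (cases "m = 2") (use \<beta>_pred_m in auto)
  then show False using not_\<beta>_1 not_at_m a1 by auto
qed

lemma not_\<beta>_pred_N: "\<not> \<beta> (N - 1)"
proof -
  interpret M: chord_pattern N m k "\<lambda>s. \<beta> (N - s)" "\<lambda>s. \<alpha> (N - s)" by (rule mirror)
  show ?thesis by (rule M.not_\<alpha>_1)
qed

text \<open>Depending on the position of \<open>p\<close>, one further chord,
  \<open>\<beta> (m + 1)\<close>, \<open>\<alpha> (k - 1)\<close> or \<open>\<beta> (m - 1)\<close>,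
  completes a shape excluded by \<open>A\<close> or \<open>B\<close>.\<close>

lemma not_\<alpha>_Suc:
  assumes "p < N" "\<beta> p" shows "\<not> \<alpha> (Suc p)"
proof
  assume a: "\<alpha> (Suc p)"
  consider "p < m" | "k \<le> p" | "m \<le> p" "p < k" by linarith
  then show False
  proof cases
    case 1
    have "\<beta> (1 + m)" using T1[of 1] not_\<alpha>_1 k_ge by simp
    then show False using A[of p "Suc p" "m + 1"] a assms 1 k_ge N_eq by auto
  next
    case 2
    have "\<alpha> (k - 1)" using T1[of "k - 1"] not_\<beta>_pred_N k_ge N_eq by (simp add: add.commute)
    then have "\<not> \<beta> p" by (intro B[of "k - 1" p "Suc p"]) (use a assms 2 k_ge in auto)
    then show False using assms by simp
  next
    case 3
    then have "\<alpha> p" using \<beta>_imp_\<alpha> assms by simp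
    then have "\<not> \<beta> (Suc p)"
      using A[of "m - 1" p "Suc p"] 3 \<beta>_pred_m m_pos assms by auto
    then show False using \<alpha>_imp_\<beta>[of "Suc p"] 3 assms a by auto
  qed
qed

text \<open>As \<open>m + 1\<close> and \<open>1 - k\<close> agree modulo \<open>N\<close>, this makes \<open>k - 1\<close> a period of \<open>\<beta>\<close>.\<close>

lemma \<beta>_shift:
  assumes "p < N" shows "\<beta> p \<longleftrightarrow> \<beta> ((p + m + 1) mod N)"
proof -
  let ?f = "\<lambda>p. (p + m + 1) mod N" and ?S = "{p. p < N \<and> \<beta> p}"
  have "N > 0" using N_eq m_pos by simp
  \<comment> \<open>\<open>T1\<close> serves the labels with \<open>p + m + 1 \<le> N\<close> and
    \<open>T2\<close> those that wrap around; at \<open>p + m + 1 = N\<close> the value is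
    \<open>\<beta> 0\<close>.\<close>
  have maps: "\<beta> (?f p)" if "p < N" "\<beta> p" for p
  proof (cases "Suc p \<le> k")
    case True
    then have b: "\<beta> (Suc p + m)" using T1[of "Suc p"] not_\<alpha>_Suc[OF that] by simp
    show ?thesis
    proof (cases "p + m + 1 = N")
      case True then show ?thesis using ends by simp
    next
      case False
      then have "p + m + 1 < N" using \<open>Suc p \<le> k\<close> N_eq by simp
      then show ?thesis using b by simp
    qed
  next
    case False
    then have "p + m + 1 = (Suc p - k) + N" "Suc p - k < N" using that N_eq m_pos k_ge by auto
    then have "?f p = Suc p - k" by simp
    then show ?thesis
      using T2[of "Suc p - k"] not_\<alpha>_Suc[OF that] False that N_eq by simp
  qed
  have inj: "inj_on ?f {..<N}"
  proof (rule inj_onI)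
    fix x y assume xy: "x \<in> {..<N}" "y \<in> {..<N}" "?f x = ?f y"
    have "?f z = (if z + m + 1 < N then z + m + 1 else z + m + 1 - N)" if "z < N" for z
      using that N_eq k_ge by (auto simp: mod_if)
    with xy show "x = y" by (auto split: if_splits)
  qed
  \<comment> \<open>The implication is reversed by counting: an injective map of the finite set
    \<open>?S\<close> into itself is onto.\<close>
  have "?f ` ?S \<subseteq> ?S" using maps \<open>N > 0\<close> by auto
  moreover have "inj_on ?f ?S" using inj by (rule inj_on_subset) auto
  ultimately have "?f ` ?S = ?S" by (intro endo_inj_surj) auto
  then have "\<beta> p" if "\<beta> (?f p)"
  proof -
    have "?f p \<in> ?f ` ?S" using that \<open>N > 0\<close> \<open>?f ` ?S = ?S\<close> by simp
    then obtain p' where "p' < N" "\<beta> p'" "?f p = ?f p'" by auto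
    then show "\<beta> p" using inj assms by (auto dest: inj_onD)
  qed
  then show ?thesis using maps assms by blast
qed

text \<open>\<open>T1\<close> or \<open>T2\<close> turns \<open>\<alpha> (Suc p)\<close> into the
  negation of \<beta> at \<open>p + m + 1\<close> modulo \<open>N\<close>, and
  \<open>\<beta>_shift\<close> moves this label back to \<open>p\<close>.\<close>

lemma \<alpha>_Suc_iff: assumes "p < N" shows "\<alpha> (Suc p) \<longleftrightarrow> \<not> \<beta> p"
proof (cases "Suc p \<le> k")
  case True
  then have "\<alpha> (Suc p) \<longleftrightarrow> \<not> \<beta> (Suc p + m)" using T1 by blast
  moreover have "\<beta> (Suc p + m) \<longleftrightarrow> \<beta> ((p + m + 1) mod N)"
    using True N_eq ends by (cases "p + m + 1 = N") (auto simp: not_less add.commute)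
  ultimately show ?thesis using \<beta>_shift[OF assms] by simp
next
  case False
  then have "p + m + 1 = (Suc p - k) + N" "Suc p - k < N" using assms N_eq m_pos k_ge by auto
  then have "(p + m + 1) mod N = Suc p - k" by simp
  then show ?thesis
    using T2[of "Suc p - k"] \<beta>_shift[OF assms] False assms N_eq by simp
qed

text \<open>Up to \<open>h = k - 1\<close> the facts about successors make \<beta> alternate,
  starting from \<open>\<beta> 0\<close>. As \<open>h\<close> is a period, \<open>\<beta> h\<close>
  holds, so \<open>h\<close> is even and the alternation spreads to all labels below
  \<open>N\<close>. Then \<open>N\<close> is even because \<open>\<beta> (N - 1)\<close>
  fails.\<close>

lemma \<beta>_iff_even: assumes "s \<le> N" shows "\<beta> s \<longleftrightarrow> even s"
proof -
  define h where "h = k - 1"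
  have per: "\<beta> s \<longleftrightarrow> \<beta> (s - h)" if "h \<le> s" "s < N" for s
  proof -
    have "s + m + 1 = (s - h) + N" "s - h < N" using that N_eq k_ge by (auto simp: h_def)
    then have "(s + m + 1) mod N = s - h" by simp
    then show ?thesis using \<beta>_shift[OF that(2)] by simp
  qed
  have alt: "\<beta> (Suc s) \<longleftrightarrow> \<not> \<beta> s" if "Suc s \<le> h" for s
  proof
    show "\<not> \<beta> s" if "\<beta> (Suc s)"
      using \<beta>_imp_\<alpha>[of "Suc s"] that \<open>Suc s \<le> h\<close> \<alpha>_Suc_iff[of s] N_eq by (simp add: h_def)
    show "\<beta> (Suc s)" if "\<not> \<beta> s"
    proof -
      have less: "s + m + 1 < N" "Suc s + m + 1 \<le> N" using \<open>Suc s \<le> h\<close> N_eq by (auto simp: h_def)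
      then have "\<not> \<beta> (s + m + 1)" using \<beta>_shift[of s] that by simp
      then have "\<alpha> (Suc s + m + 1)" using \<alpha>_Suc_iff[of "s + m + 1"] less by simp
      then have b: "\<beta> (Suc s + m + 1)" using \<alpha>_imp_\<beta>[of "Suc s + m + 1"] less by simp
      show "\<beta> (Suc s)"
      proof (cases "Suc s + m + 1 = N")
        case True
        then show ?thesis using \<beta>_shift[of "Suc s"] ends by simp
      next
        case False
        then show ?thesis using \<beta>_shift[of "Suc s"] b less by simp
      qed
    qed
  qed
  have low: "\<beta> s \<longleftrightarrow> even s" if "s \<le> h" for s
    using that by (induction s) (use ends alt in auto)
  have "h < N" using N_eq k_ge m_pos by (simp add: h_def)
  then have "even h" using per[of h] low[of h] ends by simp
  have "h > 0" using k_ge by (simp add: h_def)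
  have lessN: "\<beta> s \<longleftrightarrow> even s" if "s < N" for s
    using that
  proof (induction s rule: less_induct)
    case (less s)
    show ?case
    proof (cases "s \<le> h")
      case False
      then have "\<beta> s \<longleftrightarrow> \<beta> (s - h)" using per less.prems by simp
      also have "\<dots> \<longleftrightarrow> even (s - h)" using less False \<open>h > 0\<close> by simp
      finally show ?thesis using \<open>even h\<close> False by simp
    qed (rule low)
  qed
  have "even N" using lessN[of "N - 1"] not_\<beta>_pred_N N_eq m_pos by simp
  then show ?thesis using lessN[of s] assms ends by (cases "s = N") auto
qed

lemma even_N: "even N"
  using \<beta>_iff_even[of N] ends by simp

lemma \<alpha>_iff_even: "s \<le> N \<Longrightarrow> \<alpha> s \<longleftrightarrow> even s"
  using \<alpha>_Suc_iff[of "s - 1"] \<beta>_iff_even[of "s - 1"] ends by (cases s) auto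

end

section \<open>Graphs labelled along a Hamiltonian cycle\<close>

lemma has_cycleI:
  assumes "xs \<noteq> []" "distinct xs" "set xs \<subseteq> V" "successively E xs" "E (last xs) (hd xs)"
  shows "has_cycle V E (length xs)"
  unfolding has_cycle_def
proof (intro exI conjI allI impI)
  fix j assume j: "j < length xs"
  show "E (xs ! j) (xs ! ((j + 1) mod length xs))"
  proof (cases "Suc j < length xs")
    case True
    then show ?thesis using assms(4) by (simp add: successively_conv_nth)
  next
    case False
    then have "Suc j = length xs" using j by simp
    then have "xs ! j = last xs" "(j + 1) mod length xs = 0"
      using assms(1) by (auto simp: last_conv_nth simp flip: \<open>Suc j = length xs\<close>)
    then show ?thesis using assms(1,5) by (simp add: hd_conv_nth)
  qed
qed (use assms in auto)

lemma has_cycle_map: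
  assumes "has_cycle W R l" "inj_on f W" "f ` W \<subseteq> V" "\<And>i j. i \<in> W \<Longrightarrow> j \<in> W \<Longrightarrow> R i j \<Longrightarrow> E (f i) (f j)"
  shows "has_cycle V E l"
proof -
  obtain xs where xs: "length xs = l" "distinct xs" "set xs \<subseteq> W"
    "\<forall>j<l. R (xs ! j) (xs ! ((j + 1) mod l))"
    using assms(1) unfolding has_cycle_def by blast
  have mem: "xs ! j \<in> W" if "j < l" for j using xs that by auto
  show ?thesis
    unfolding has_cycle_def
  proof (intro exI[of _ "map f xs"] conjI allI impI)
    show "distinct (map f xs)" using xs assms(2) by (auto simp: distinct_map intro: inj_on_subset)
    show "set (map f xs) \<subseteq> V" using xs assms(3) by auto
    fix j assume j: "j < l"
    then have "(j + 1) mod l < l" by simp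
    with j show "E (map f xs ! j) (map f xs ! ((j + 1) mod l))"
      using xs assms(4) mem by simp
  qed (use xs in auto)
qed

lemma inj_on_add_mod: "inj_on (\<lambda>i::nat. (i + r) mod n) {..<n}"
proof (rule linorder_inj_onI')
  fix x y :: nat assume "x \<in> {..<n}" "y \<in> {..<n}" "x < y"
  then have "\<not> n dvd (y + r) - (x + r)" by (simp add: nat_dvd_not_less)
  then show "(x + r) mod n \<noteq> (y + r) mod n"
    using mod_eq_dvd_iff_nat[of "x + r" "y + r" n] \<open>x < y\<close> by auto
qed

lemma sum_le_1_ge_card_imp_eq_1:
  fixes f :: "'b \<Rightarrow> nat"
  assumes "finite A" "\<And>x. x \<in> A \<Longrightarrow> f x \<le> 1" "card A \<le> sum f A" "x \<in> A"
  shows "f x = 1"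
proof (rule ccontr)
  assume "f x \<noteq> 1"
  then have "f x < 1" using assms(2)[OF assms(4)] by simp
  then have "sum f A < (\<Sum>x\<in>A. 1)"
    by (intro sum_strict_mono_ex1) (use assms in auto)
  then show False using assms(3) by simp
qed

text \<open>Of two consecutive labels exactly one has parity opposite to \<open>x\<close>. This
  bounds the degree of a vertex all of whose neighbours lie in the other parity class.\<close>

lemma card_odd_sum_le: "card {u. u < 2 * h \<and> odd (x + u)} \<le> h"
proof (induction h)
  case (Suc h)
  let ?w = "if odd (x + 2 * h) then 2 * h else 2 * h + 1"
  have "{u. u < 2 * Suc h \<and> odd (x + u)} \<subseteq> insert ?w {u. u < 2 * h \<and> odd (x + u)}"
  proof
    fix u assume u: "u \<in> {u. u < 2 * Suc h \<and> odd (x + u)}"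
    then consider "u < 2 * h" | "u = 2 * h" | "u = 2 * h + 1" by fastforce
    then show "u \<in> insert ?w {u. u < 2 * h \<and> odd (x + u)}" using u by cases auto
  qed
  then have "card {u. u < 2 * Suc h \<and> odd (x + u)} \<le> card (insert ?w {u. u < 2 * h \<and> odd (x + u)})"
    by (intro card_mono) auto
  also have "\<dots> \<le> Suc (card {u. u < 2 * h \<and> odd (x + u)})" by (rule card_insert_le_m1) simp_all
  finally show ?case using Suc by simp
qed simp

locale ham_labelling =
  fixes n :: nat and R :: "nat \<Rightarrow> nat \<Rightarrow> bool"
  assumes n_ge: "3 \<le> n"
    and sym: "\<And>i j. R i j \<Longrightarrow> R j i"
    and irrefl: "\<And>i. \<not> R i i"
    and step: "\<And>i. Suc i < n \<Longrightarrow> R i (Suc i)"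
    and close: "R (n - 1) 0"
begin

text \<open>The shift by one lets \<alpha> and \<beta> range over the same indices
  \<open>0..n - 2\<close> and hold at both ends of this range.\<close>

definition \<alpha> :: "nat \<Rightarrow> bool" where "\<alpha> s \<longleftrightarrow> R 0 (Suc s)"
definition \<beta> :: "nat \<Rightarrow> bool" where "\<beta> p \<longleftrightarrow> R (n - 1) p"

abbreviation cyc :: "nat \<Rightarrow> bool" where "cyc \<equiv> has_cycle {..<n} R"

abbreviation deg :: "nat \<Rightarrow> nat" where "deg \<equiv> degree {..<n} R"

lemma ends: "\<alpha> 0" "\<alpha> (n - 2)" "\<beta> 0" "\<beta> (n - 2)"
proof -
  show "\<alpha> 0" using step[of 0] n_ge by (simp add: \<alpha>_def)
  show "\<alpha> (n - 2)" using sym[OF close] n_ge by (simp add: \<alpha>_def numeral_2_eq_2 Suc_diff_Suc)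
  show "\<beta> 0" using close by (simp add: \<beta>_def)
  show "\<beta> (n - 2)" using sym[OF step[of "n - 2"]] n_ge by (simp add: \<beta>_def numeral_2_eq_2 Suc_diff_Suc)
qed

section \<open>Reflections and rotations of the labelling\<close>

lemma reflection: "ham_labelling n (\<lambda>i j. R (n - 1 - i) (n - 1 - j))"
proof
  show "3 \<le> n" by (rule n_ge)
  show "R (n - 1 - i) (n - 1 - Suc i)" if "Suc i < n" for i
    using sym[OF step[of "n - 1 - Suc i"]] that by (simp add: Suc_diff_Suc)
  show "R (n - 1 - (n - 1)) (n - 1 - 0)" using sym[OF close] by simp
qed (use sym irrefl in auto)

lemma cyc_reflection:
  assumes "has_cycle {..<n} (\<lambda>i j. R (n - 1 - i) (n - 1 - j)) l" shows "cyc l"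
  by (rule has_cycle_map[OF assms, where f = "\<lambda>i. n - 1 - i"]) (auto intro: inj_onI)

lemma rotation: "ham_labelling n (\<lambda>i j. R ((i + r) mod n) ((j + r) mod n))"
proof
  have cyc_step: "R (i mod n) (Suc i mod n)" for i
  proof (cases "Suc (i mod n) = n")
    case True
    then show ?thesis using close by (metis diff_Suc_1 mod_Suc)
  next
    case False
    then show ?thesis using step[of "i mod n"] n_ge by (simp add: mod_Suc Suc_lessI)
  qed
  show "3 \<le> n" by (rule n_ge)
  show "R ((i + r) mod n) ((Suc i + r) mod n)" for i using cyc_step[of "i + r"] by simp
  show "R ((n - 1 + r) mod n) ((0 + r) mod n)"
    using cyc_step[of "n - 1 + r"] n_ge by simp
qed (use sym irrefl in auto)

lemma bij_rotation: "bij_betw (\<lambda>i. (i + r) mod n) {..<n} {..<n}"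
  unfolding bij_betw_def
  by (intro conjI inj_on_add_mod endo_inj_surj) (use n_ge in auto)

lemma cyc_rotation:
  assumes "has_cycle {..<n} (\<lambda>i j. R ((i + r) mod n) ((j + r) mod n)) l" shows "cyc l"
  by (rule has_cycle_map[OF assms inj_on_add_mod]) (use n_ge in auto)

lemma degree_rotation:
  assumes "i < n"
  shows "degree {..<n} (\<lambda>i j. R ((i + r) mod n) ((j + r) mod n)) i = deg ((i + r) mod n)"
proof -
  let ?f = "\<lambda>i. (i + r) mod n"
  have "?f ` {j \<in> {..<n}. R (?f i) (?f j)} = {j \<in> {..<n}. R (?f i) j}"
    (is "?L = ?R")
  proof
    show "?L \<subseteq> ?R" using n_ge by auto
    show "?R \<subseteq> ?L"
    proof
      fix j assume j: "j \<in> ?R"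
      then obtain j' where "j' < n" "j = ?f j'"
        using bij_rotation[of r] unfolding bij_betw_def by blast
      then show "j \<in> ?L" using j by blast
    qed
  qed
  moreover have "inj_on ?f {j \<in> {..<n}. R (?f i) (?f j)}"
    using inj_on_add_mod by (rule inj_on_subset) auto
  then have "card (?f ` {j \<in> {..<n}. R (?f i) (?f j)}) = card {j \<in> {..<n}. R (?f i) (?f j)}"
    by (rule card_image)
  ultimately show ?thesis unfolding degree_def by simp
qed

section \<open>Cycles from chords at the vertices \<open>0\<close> and \<open>n - 1\<close>\<close>

lemma up_path: "b \<le> n \<Longrightarrow> successively R [a..<b]"
  by (auto simp: successively_conv_nth intro!: step)

lemma down_path: "b \<le> n \<Longrightarrow> successively (\<lambda>i j. R j i) [a..<b]"
  by (rule successively_mono[OF up_path]) (auto intro: sym)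

lemma cycI:
  assumes "js \<noteq> []" "distinct js" "set js \<subseteq> {..<n}" "successively R js" "R (last js) (hd js)" "length js = l"
  shows "cyc l"
  using has_cycleI[of js "{..<n}" R] assms by simp

lemmas path_simps = successively_append_iff successively_Cons up_path down_path hd_append last_append
  hd_rev last_rev

lemma cyc_n: "cyc n"
  by (rule cycI[of "[0..<n]"]) (use close n_ge in \<open>auto simp: path_simps\<close>)

lemma deg_0: "deg 0 = (\<Sum>s\<le>n - 2. of_bool (\<alpha> s))"
proof -
  have "{u \<in> {..<n}. R 0 u} = Suc ` {s \<in> {..n - 2}. \<alpha> s}" (is "?L = ?R")
  proof (rule set_eqI)
    fix u
    show "u \<in> ?L \<longleftrightarrow> u \<in> ?R"
      using irrefl n_ge by (cases u) (auto simp: \<alpha>_def image_iff)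
  qed
  then show ?thesis by (simp add: degree_def card_image sum.If_cases of_bool_def Int_def)
qed

lemma deg_last: "deg (n - 1) = (\<Sum>s\<le>n - 2. of_bool (\<beta> s))"
proof -
  have "{u \<in> {..<n}. R (n - 1) u} = {s \<in> {..n - 2}. \<beta> s}" (is "?L = ?R")
  proof (rule set_eqI)
    fix u
    show "u \<in> ?L \<longleftrightarrow> u \<in> ?R"
      using irrefl[of "n - 1"] n_ge by (cases "u = n - 1") (auto simp: \<beta>_def)
  qed
  then show ?thesis by (simp add: degree_def sum.If_cases of_bool_def Int_def)
qed

text \<open>This cycle is behind \<open>F1\<close> of \<open>chord_pattern\<close>; the next four
  are behind one direction each of \<open>T1\<close> and \<open>T2\<close>, then \<open>A\<close>
  and \<open>C1\<close>. The other shapes are reflections of these.\<close>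

lemma cyc_same_side:
  assumes "n = m + k + 2" "1 \<le> m" "s \<le> k" "\<alpha> s" "\<alpha> (s + m)"
  shows "cyc (m + 2)"
  by (rule cycI[of "0 # [s + 1..<s + m + 2]"])
     (use assms sym in \<open>auto simp: path_simps \<alpha>_def simp del: upt_Suc\<close>)

lemma cyc_up:
  assumes "n = m + k + 2" "1 \<le> m" "s \<le> k" "\<alpha> s" "\<beta> (s + m)"
  shows "cyc (m + 2)"
  by (rule cycI[of "0 # [s + 1..<s + m + 1] @ [n - 1]"])
     (use assms[unfolded \<alpha>_def \<beta>_def] sym close in \<open>auto simp: path_simps simp del: upt_Suc\<close>)

lemma cyc_around:
  assumes "n = m + k + 2" "1 \<le> k" "s \<le> m" "\<beta> s" "\<alpha> (s + k)"
  shows "cyc (m + 2)"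
  by (rule cycI[of "[0..<s + 1] @ rev [s + k + 1..<n]"])
     (use assms[unfolded \<alpha>_def \<beta>_def] sym in \<open>auto simp: path_simps simp del: upt_Suc\<close>)

lemma cyc_three_chords:
  assumes "n = m + k + 2" "p \<le> s" "s < q" "q \<le> m + k" "p + q = m + s" "\<beta> p" "\<alpha> s" "\<beta> q"
  shows "cyc (m + 2)"
  by (rule cycI[of "[0..<p + 1] @ (n - 1) # rev [s + 1..<q + 1]"])
     (use assms[unfolded \<alpha>_def \<beta>_def] sym in \<open>auto simp: path_simps simp del: upt_Suc\<close>)

lemma cyc_twisted:
  assumes "n = m + k + 2" "x < m" "1 \<le> k" "\<beta> 1" "\<alpha> x" "\<alpha> (k + x + 1)"
  shows "cyc (m + 2)"
  by (rule cycI[of "0 # rev [1..<x + 2] @ rev [k + x + 2..<n]"])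
     (use assms[unfolded \<alpha>_def \<beta>_def] sym in \<open>auto simp: path_simps simp del: upt_Suc\<close>)

text \<open>The chord count. For \<open>s \<le> k\<close> the chords \<open>\<alpha> s\<close> and
  \<open>\<beta> (s + m)\<close> exclude each other, and so do \<open>\<beta> s\<close> and
  \<open>\<alpha> (s + k)\<close> for \<open>s \<le> m\<close>. These are
  \<open>(k + 1) + (m + 1) = n\<close> pairs covering all chords at the two ends, so the degree sum
  is at most \<open>n\<close>, and equality means that each pair contains exactly one chord.\<close>

lemma
  assumes "\<not> cyc (m + 2)" and n: "n = m + k + 2" and m: "1 \<le> m" and k: "1 \<le> k"
  shows deg_ends_le: "deg 0 + deg (n - 1) \<le> n"
    and tight_up: "\<And>s. n \<le> deg 0 + deg (n - 1) \<Longrightarrow> s \<le> k \<Longrightarrow> \<alpha> s \<longleftrightarrow> \<not> \<beta> (s + m)"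
    and tight_around: "\<And>s. n \<le> deg 0 + deg (n - 1) \<Longrightarrow> s \<le> m \<Longrightarrow> \<beta> s \<longleftrightarrow> \<not> \<alpha> (s + k)"
proof -
  define x y :: "nat \<Rightarrow> nat" where "x = (\<lambda>s. of_bool (\<alpha> s))" and "y = (\<lambda>s. of_bool (\<beta> s))"
  have up: "x s + y (s + m) \<le> 1" if "s \<le> k" for s
    using cyc_up[OF n m that] assms(1) by (auto simp: x_def y_def)
  have around: "y s + x (s + k) \<le> 1" if "s \<le> m" for s
    using cyc_around[OF n k that] assms(1) by (auto simp: x_def y_def)
  \<comment> \<open>The indices \<open>k\<close> of \<alpha> and \<open>m\<close> of \<beta> occur
    in two pairs each; both terms vanish, so nothing is counted twice.\<close>
  have "x k = 0" "y m = 0"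
    using up[of 0] up[of k] ends n by (auto simp: x_def y_def add.commute)
  have split: "(\<Sum>s\<le>a + b. f s) = (\<Sum>s<a. f s) + (\<Sum>s\<le>b. f (s + a))" for a b and f :: "nat \<Rightarrow> nat"
    by (induction b) (simp_all add: lessThan_Suc_atMost[symmetric] add_ac)
  have "deg 0 = (\<Sum>s\<le>k + m. x s)" "deg (n - 1) = (\<Sum>s\<le>m + k. y s)"
    using deg_0 deg_last n by (simp_all add: x_def y_def add.commute)
  then have "deg 0 = (\<Sum>s\<le>k. x s) + (\<Sum>s\<le>m. x (s + k))"
    "deg (n - 1) = (\<Sum>s\<le>m. y s) + (\<Sum>s\<le>k. y (s + m))"
    using \<open>x k = 0\<close> \<open>y m = 0\<close> unfolding split by (simp_all add: lessThan_Suc_atMost[symmetric])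
  then have total: "deg 0 + deg (n - 1) = (\<Sum>s\<le>k. x s + y (s + m)) + (\<Sum>s\<le>m. y s + x (s + k))"
    by (simp add: sum.distrib)
  have le: "(\<Sum>s\<le>k. x s + y (s + m)) \<le> k + 1" "(\<Sum>s\<le>m. y s + x (s + k)) \<le> m + 1"
    using sum_mono[of "{..k}" "\<lambda>s. x s + y (s + m)" "\<lambda>_. 1"] up
      sum_mono[of "{..m}" "\<lambda>s. y s + x (s + k)" "\<lambda>_. 1"] around by auto
  then show "deg 0 + deg (n - 1) \<le> n" using total n by simp
  assume tight: "n \<le> deg 0 + deg (n - 1)"
  show "\<alpha> s \<longleftrightarrow> \<not> \<beta> (s + m)" if "s \<le> k" for s
  proof -
    have "x s + y (s + m) = 1"
      by (rule sum_le_1_ge_card_imp_eq_1[where A = "{..k}"]) (use up le total tight n that in auto)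
    then show ?thesis by (auto simp: x_def y_def of_bool_def split: if_splits)
  qed
  show "\<beta> s \<longleftrightarrow> \<not> \<alpha> (s + k)" if "s \<le> m" for s
  proof -
    have "y s + x (s + k) = 1"
      by (rule sum_le_1_ge_card_imp_eq_1[where A = "{..m}"]) (use around le total tight n that in auto)
    then show ?thesis by (auto simp: x_def y_def of_bool_def split: if_splits)
  qed
qed

lemma pancyclic_if_deg_sum_gt:
  assumes "n < deg 0 + deg (n - 1)" "3 \<le> l" "l \<le> n"
  shows "cyc l"
proof (cases "l = n")
  case False
  with assms have *: "n = (l - 2) + (n - l) + 2" "1 \<le> l - 2" "1 \<le> n - l" by auto
  have "cyc (l - 2 + 2)"
  proof (rule ccontr)
    assume "\<not> cyc (l - 2 + 2)"
    from deg_ends_le[OF this *] show False using assms(1) by simp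
  qed
  moreover have "l - 2 + 2 = l" using assms by simp
  ultimately show ?thesis by simp
qed (use cyc_n in simp)

section \<open>The bipartite chord pattern\<close>

text \<open>The ends are joined as in the balanced complete bipartite graph whose classes are the
  even and the odd labels: \<open>0\<close> to exactly the odd ones, \<open>n - 1\<close> to exactly
  the even ones. Chords between other vertices are left open.\<close>

definition alternating :: bool where
  "alternating \<longleftrightarrow> even n \<and> (\<forall>s\<le>n - 2. (\<alpha> s \<longleftrightarrow> even s) \<and> (\<beta> s \<longleftrightarrow> even s))"

text \<open>The missing length is written \<open>m + 2\<close>, and \<open>l \<le> n - 2\<close>
  gives \<open>k \<ge> 2\<close>, so that \<open>chord_pattern\<close> applies. Its assumptions
  \<open>F2\<close>, \<open>B\<close> and \<open>C2\<close> come from the cycle lemmas in the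
  reflected labelling.\<close>

lemma alternating_if_cycle_missing:
  assumes miss: "\<not> cyc l" and l: "3 \<le> l" "l \<le> n - 2" and tight: "n \<le> deg 0 + deg (n - 1)"
  shows alternating
proof -
  define m k where "m = l - 2" and "k = n - l"
  have n: "n = m + k + 2" and m: "1 \<le> m" and k: "1 \<le> k" and "2 \<le> k" and l_eq: "l = m + 2"
    using l n_ge by (auto simp: m_def k_def)
  have miss: "\<not> cyc (m + 2)" using assms l_eq by simp
  define R' where "R' = (\<lambda>i j. R (n - 1 - i) (n - 1 - j))"
  interpret M: ham_labelling n R' unfolding R'_def by (rule reflection)
  have M_\<alpha>: "M.\<alpha> s \<longleftrightarrow> \<beta> (m + k - s)" for s unfolding M.\<alpha>_def \<beta>_def unfolding R'_def by (simp add: n)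
  have M_\<beta>: "M.\<beta> s \<longleftrightarrow> \<alpha> (m + k - s)" if "s \<le> m + k" for s
    unfolding M.\<beta>_def \<alpha>_def unfolding R'_def using that by (simp add: n Suc_diff_le)
  have M_miss: "\<not> M.cyc (m + 2)" using cyc_reflection miss unfolding R'_def by blast
  interpret chord_pattern "m + k" m k \<alpha> \<beta>
  proof
    show "m + k = m + k" "1 \<le> m" "2 \<le> k" by (simp_all add: m \<open>2 \<le> k\<close> del: One_nat_def)
    show "\<alpha> 0" "\<alpha> (m + k)" "\<beta> 0" "\<beta> (m + k)" using ends n by auto
    show "\<alpha> s \<longleftrightarrow> \<not> \<beta> (s + m)" if "s \<le> k" for s by (rule tight_up) fact+
    show "\<beta> s \<longleftrightarrow> \<not> \<alpha> (s + k)" if "s \<le> m" for s by (rule tight_around) fact+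
    show "\<not> \<alpha> (s + m)" if "s \<le> k" "\<alpha> s" for s using cyc_same_side[OF n m that] miss by blast
    show "\<not> \<beta> (s + m)" if "s \<le> k" "\<beta> s" for s
      using M.cyc_same_side[OF n m, of "k - s"] M_miss that by (auto simp: M_\<alpha> add.commute)
    show "\<not> \<beta> q" if "p \<le> s" "s < q" "q \<le> m + k" "p + q = m + s" "\<beta> p" "\<alpha> s" for p q s
      using cyc_three_chords[OF n that] miss by blast
    show "\<not> \<beta> s" if "q < s" "s \<le> p" "p \<le> m + k" "p + q = k + s" "\<alpha> p" "\<alpha> q" for p q s
    proof
      assume "\<beta> s"
      then have "M.cyc (m + 2)"
        by (intro M.cyc_three_chords[OF n, of "m + k - p" "m + k - s" "m + k - q"])
          (use that in \<open>auto simp: M_\<alpha> M_\<beta>\<close>)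
      then show False using M_miss by simp
    qed
    show "\<not> \<alpha> (k + x + 1)" if "x < m" "\<beta> 1" "\<alpha> x" for x
      using cyc_twisted[OF n that(1) k that(2,3)] miss by blast
    show "\<not> \<beta> (m - x - 1)" if "x < m" "\<alpha> (m + k - 1)" "\<beta> (m + k - x)" for x
      using M.cyc_twisted[OF n that(1) k] M_miss that k by (auto simp: M_\<alpha> M_\<beta>)
  qed
  have "m + k = n - 2" "even n" using n even_N by auto
  then show ?thesis using \<alpha>_iff_even \<beta>_iff_even by (auto simp: alternating_def)
qed

lemma alternating_chord_0:
  assumes alternating "0 < c" "c < n" shows "R 0 c \<longleftrightarrow> odd c"
  using assms n_ge by (cases c) (auto simp: alternating_def \<alpha>_def)

lemma alternating_chord_last:
  assumes alternating "c < n - 1" shows "R (n - 1) c \<longleftrightarrow> even c"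
  using assms n_ge by (auto simp: alternating_def \<beta>_def)

text \<open>The chord joins two even labels and is the only edge used that stays inside a parity
  class, which makes the cycle length odd. The rest is closed up through \<open>0\<close>, joined to
  all odd labels, and \<open>n - 1\<close>, joined to all even ones.\<close>

lemma alternating_odd_cycle:
  assumes alt: alternating and chord: "R p q" and pq: "p < q" "even p" "even q" "q < n"
    and l: "3 \<le> l" "l < n" "odd l"
  shows "cyc l"
proof -
  have "even n" using alt by (simp add: alternating_def)
  have zero: "R c 0" if "odd c" "c < n" for c
    using alternating_chord_0[OF alt, of c] that sym by (auto elim: oddE)
  have last: "R (n - 1) c" "R c (n - 1)" if "even c" "c < n - 1" for c
    using alternating_chord_last[OF alt that(2)] that sym by auto
  have "p \<noteq> 0" using alternating_chord_0[OF alt, of q] chord pq by (cases "p = 0") auto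
  then have "2 \<le> p" using pq by (cases "p = 1") auto
  have "q < n - 1" using pq \<open>even n\<close> n_ge by (cases "q = n - 1") auto
  \<comment> \<open>In the three longer ranges the free end \<open>c\<close>, \<open>e\<close> or
    \<open>f\<close> is solved from the required length; its parity makes it a neighbour of
    \<open>0\<close> or of \<open>n - 1\<close>.\<close>
  consider "l = 3" | "5 \<le> l" "l \<le> p + 3" | "p + 3 < l" "l + q \<le> n + p + 1" | "n + p + 1 < l + q"
    using l by (cases "l = 4") (simp, linarith)
  then show ?thesis
  proof cases
    case 1
    show ?thesis
      by (rule cycI[of "[p, q, n - 1]"]) (use 1 chord last pq \<open>q < n - 1\<close> in auto)
  next
    case 2
    define c where "c = p + 4 - l"
    have c: "odd c" "c \<le> p" "l = p + 4 - c" using 2 pq l by (auto simp: c_def)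
    then have "0 < c" by (auto elim: oddE)
    show ?thesis
      by (rule cycI[of "0 # [c..<p + 1] @ [q..<q + 2]"])
        (use c \<open>0 < c\<close> chord pq zero[of c] sym zero[of "q + 1"] \<open>q < n - 1\<close>
          in \<open>auto simp: path_simps simp del: upt_Suc\<close>)
  next
    case 3
    define e where "e = l + q - p - 2"
    have e: "odd e" "q < e" "e < n" "l = e + p + 2 - q" using 3 pq l by (auto simp: e_def)
    show ?thesis
      by (rule cycI[of "[0..<p + 1] @ [q..<e + 1]"])
        (use e chord pq zero[of e] in \<open>auto simp: path_simps simp del: upt_Suc\<close>)
  next
    case 4
    define f where "f = n + p + 1 - l"
    have f: "even f" "p < f" "f \<le> q" "l = n + p + 1 - f" using 4 pq l \<open>even n\<close> by (auto simp: f_def)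
    show ?thesis
      by (rule cycI[of "[0..<p + 1] @ rev [f..<q + 1] @ rev [q + 1..<n]"])
        (use f chord pq zero[of "q + 1"] last[of f] \<open>q < n - 1\<close>
          in \<open>auto simp: path_simps simp del: upt_Suc\<close>)
  qed
qed

lemma alternating_reflection:
  assumes alternating
  shows "ham_labelling.alternating n (\<lambda>i j. R (n - 1 - i) (n - 1 - j))"
proof -
  define R' where "R' = (\<lambda>i j. R (n - 1 - i) (n - 1 - j))"
  interpret M: ham_labelling n R' unfolding R'_def by (rule reflection)
  have "M.\<alpha> s \<longleftrightarrow> \<beta> (n - 2 - s)" "M.\<beta> s \<longleftrightarrow> \<alpha> (n - 2 - s)" if "s \<le> n - 2" for s
  proof -
    have "n - 1 - Suc s = n - 2 - s" "n - 1 - s = Suc (n - 2 - s)" using that n_ge by auto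
    then show "M.\<alpha> s \<longleftrightarrow> \<beta> (n - 2 - s)" "M.\<beta> s \<longleftrightarrow> \<alpha> (n - 2 - s)"
      unfolding M.\<alpha>_def \<beta>_def M.\<beta>_def \<alpha>_def unfolding R'_def by simp_all
  qed
  moreover have "even (n - 2 - s) \<longleftrightarrow> even s" if "s \<le> n - 2" for s
    using that assms n_ge by (auto simp: alternating_def)
  ultimately show ?thesis
    using assms unfolding R'_def[symmetric] by (auto simp: alternating_def M.alternating_def)
qed

text \<open>An initial segment of even length \<open>l\<close> closes up since \<open>l - 1\<close>
  is odd. Odd lengths come from the chord inside a parity class; if its ends are odd, reflection
  makes them even.\<close>

lemma alternating_pancyclic:
  assumes alt: alternating and chord: "R p q" "p < n" "q < n" "even (p + q)" and l: "3 \<le> l" "l \<le> n"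
  shows "cyc l"
proof -
  have "even n" using alt by (simp add: alternating_def)
  have "p \<noteq> q" using chord irrefl by blast
  then obtain p q where pq: "R p q" "p < q" "q < n" "even (p + q)"
    using chord sym by (metis add.commute linorder_neqE_nat)
  consider "even l" | "odd l" "even p" | "odd l" "odd p" by blast
  then show ?thesis
  proof cases
    case 1
    have "R (l - 1) 0" using alternating_chord_0[OF alt, of "l - 1"] 1 l sym by auto
    then show ?thesis
      by (intro cycI[of "[0..<l]"]) (use l in \<open>auto simp: path_simps\<close>)
  next
    case 2
    then show ?thesis
      using alternating_odd_cycle[OF alt pq(1,2)] pq l \<open>even n\<close> by (cases "l = n") auto
  next
    case 3
    define R' where "R' = (\<lambda>i j. R (n - 1 - i) (n - 1 - j))"
    interpret M: ham_labelling n R' unfolding R'_def by (rule reflection)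
    have "R' (n - 1 - q) (n - 1 - p)" using pq sym by (simp add: R'_def)
    moreover have "even (n - 1 - q)" "even (n - 1 - p)" using 3 pq \<open>even n\<close> by auto
    ultimately have "M.cyc l"
      using M.alternating_odd_cycle[OF alternating_reflection[OF alt, folded R'_def], of "n - 1 - q" "n - 1 - p"] pq l 3 \<open>even n\<close>
      by (cases "l = n") auto
    then show ?thesis unfolding R'_def by (rule cyc_reflection)
  qed
qed

section \<open>Cycles of length \<open>n - 1\<close>\<close>

lemma cyc_omit_last:
  assumes "1 \<le> j" "j \<le> n - 2" "R 0 j" "R (n - 2) (j - 1)"
  shows "cyc (n - 1)"
  by (rule cycI[of "[j..<n - 1] @ rev [0..<j]"])
     (use assms n_ge sym in \<open>auto simp: path_simps numeral_2_eq_2 simp del: upt_Suc\<close>)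

text \<open>Closing up the path through all vertices but the last: both its ends are adjacent to the
  last vertex, which contributes 2 to the degree sum.\<close>

lemma
  assumes cross: "\<And>j. 1 \<le> j \<Longrightarrow> j \<le> n - 2 \<Longrightarrow> \<not> (R 0 j \<and> R (n - 2) (j - 1))"
  shows deg_omit_last_le: "deg 0 + deg (n - 2) \<le> n"
    and tight_omit_last: "\<And>j. n \<le> deg 0 + deg (n - 2) \<Longrightarrow> 1 \<le> j \<Longrightarrow> j \<le> n - 2 \<Longrightarrow> R 0 j \<longleftrightarrow> \<not> R (n - 2) (j - 1)"
proof -
  let ?A = "{j \<in> {1..n - 2}. R 0 j}" and ?B = "{j \<in> {1..n - 2}. R (n - 2) (j - 1)}"
  have "{u \<in> {..<n}. R 0 u} \<subseteq> insert (n - 1) ?A"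
  proof
    fix u assume "u \<in> {u \<in> {..<n}. R 0 u}"
    moreover from this have "u \<noteq> 0" using irrefl[of 0] by (cases "u = 0") auto
    ultimately show "u \<in> insert (n - 1) ?A" by auto
  qed
  then have "deg 0 \<le> card (insert (n - 1) ?A)" unfolding degree_def by (intro card_mono) auto
  then have A: "deg 0 \<le> card ?A + 1" by (simp add: card_insert_if split: if_splits)
  have "{u \<in> {..<n}. R (n - 2) u} \<subseteq> insert (n - 1) ((\<lambda>j. j - 1) ` ?B)"
  proof
    fix u assume u: "u \<in> {u \<in> {..<n}. R (n - 2) u}"
    then have "u \<noteq> n - 2" using irrefl by auto
    show "u \<in> insert (n - 1) ((\<lambda>j. j - 1) ` ?B)"
    proof (cases "u = n - 1")
      case False
      then have "Suc u \<in> ?B" using u \<open>u \<noteq> n - 2\<close> by auto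
      then have "Suc u - 1 \<in> (\<lambda>j. j - 1) ` ?B" by (rule imageI)
      then show ?thesis by simp
    qed simp
  qed
  then have "deg (n - 2) \<le> card (insert (n - 1) ((\<lambda>j. j - 1) ` ?B))"
    unfolding degree_def by (intro card_mono) auto
  also have "\<dots> \<le> card ((\<lambda>j. j - 1) ` ?B) + 1" by (simp add: card_insert_if)
  also have "\<dots> \<le> card ?B + 1" by (simp add: card_image_le)
  finally have B: "deg (n - 2) \<le> card ?B + 1" .
  have un: "card (?A \<union> ?B) = card ?A + card ?B"
    by (rule card_Un_disjoint) (use cross in auto)
  have "card (?A \<union> ?B) \<le> card {1..n - 2}" by (rule card_mono) auto
  then show "deg 0 + deg (n - 2) \<le> n" using A B un n_ge unfolding card_atLeastAtMost by linarith
  assume tight: "n \<le> deg 0 + deg (n - 2)"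
  fix j assume j: "1 \<le> j" "j \<le> n - 2"
  have "card {1..n - 2} \<le> card (?A \<union> ?B)" using A B un n_ge tight unfolding card_atLeastAtMost by linarith
  then have "?A \<union> ?B = {1..n - 2}" by (intro card_seteq) auto
  moreover have "j \<in> {1..n - 2}" using j by simp
  ultimately have "j \<in> ?A \<union> ?B" by (simp only:)
  then show "R 0 j \<longleftrightarrow> \<not> R (n - 2) (j - 1)" using cross[OF j] by blast
qed

text \<open>The tight chord count for \<open>m = n - 3\<close> and \<open>k = 1\<close>, the value
  of \<open>k\<close> that \<open>chord_pattern\<close> does not cover.\<close>

lemma
  assumes miss: "\<not> cyc (n - 1)" and n4: "4 \<le> n" and tight: "n \<le> deg 0 + deg (n - 1)"
  shows not_\<alpha>_1_if_pred_missing: "\<not> \<alpha> 1"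
    and \<beta>_iff_if_pred_missing: "\<And>s. s \<le> n - 3 \<Longrightarrow> \<beta> s \<longleftrightarrow> \<not> \<alpha> (s + 1)"
proof -
  have "n - 1 = (n - 3) + 2" using n4 by simp
  then have *: "\<not> cyc ((n - 3) + 2)" "n = (n - 3) + 1 + 2" "1 \<le> n - 3" using miss n4 by auto
  have "1 + (n - 3) = n - 2" using n4 by simp
  then show "\<not> \<alpha> 1" using tight_up[OF * _ tight, of 1] ends(4) by simp
  show "\<beta> s \<longleftrightarrow> \<not> \<alpha> (s + 1)" if "s \<le> n - 3" for s
    using tight_around[OF * _ tight that] by simp
qed

lemma alternatingI:
  assumes "even n" "\<And>s. s \<le> n - 2 \<Longrightarrow> \<alpha> s \<longleftrightarrow> even s" "\<And>s. s \<le> n - 3 \<Longrightarrow> \<beta> s \<longleftrightarrow> \<not> \<alpha> (s + 1)"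
  shows alternating
  unfolding alternating_def
proof (intro conjI allI impI)
  fix s assume s: "s \<le> n - 2"
  show "\<beta> s \<longleftrightarrow> even s"
  proof (cases "s = n - 2")
    case True
    then show ?thesis using ends assms(1) by simp
  next
    case False
    then have "s \<le> n - 3" "s + 1 \<le> n - 2" using s by auto
    then show ?thesis using assms(2)[of "s + 1"] assms(3)[of s] by simp
  qed
qed (use assms in auto)


text \<open>Three consecutive vertices \<open>n - 1\<close>, \<open>0\<close>, \<open>1\<close> have
  tight pairs. Combining the three counts gives
  \<open>\<alpha> (s + 3) = (\<not> \<alpha> s)\<close>, and with the values at \<open>0\<close>,
  \<open>1\<close> and \<open>2\<close> this forces parity.\<close>

lemma alternating_if_pred_missing_1:
  assumes miss: "\<not> cyc (n - 1)" and "even n" "4 \<le> n"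
    and tight: "n \<le> deg 0 + deg (n - 1)" "n \<le> deg 0 + deg 1" "n \<le> deg 1 + deg (n - 1)"
  shows alternating
proof (rule alternatingI)
  note \<beta>_iff = \<beta>_iff_if_pred_missing[OF miss \<open>4 \<le> n\<close> tight(1)]
  show "\<beta> s \<longleftrightarrow> \<not> \<alpha> (s + 1)" if "s \<le> n - 3" for s using \<beta>_iff that .
  define R' where "R' = (\<lambda>i j. R ((i + 1) mod n) ((j + 1) mod n))"
  interpret M: ham_labelling n R' unfolding R'_def by (rule rotation)
  have M_miss: "\<not> M.cyc (n - 1)" using miss cyc_rotation unfolding R'_def by blast
  have M_deg: "M.deg i = deg ((i + 1) mod n)" if "i < n" for i
    unfolding R'_def using degree_rotation[OF that] .
  have degs: "M.deg 0 = deg 1" "M.deg (n - 1) = deg 0" "M.deg (n - 2) = deg (n - 1)"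
    using M_deg[of 0] M_deg[of "n - 1"] M_deg[of "n - 2"] \<open>4 \<le> n\<close> by (simp_all add: numeral_2_eq_2 Suc_diff_Suc)
  \<comment> \<open>The chord count with \<open>k = 1\<close> for the consecutive pair
    \<open>0\<close>, \<open>1\<close>.\<close>
  have c1: "R 1 (s + 3) \<longleftrightarrow> \<not> \<alpha> s" if "s + 3 < n" for s
  proof -
    have "M.\<beta> s \<longleftrightarrow> \<not> M.\<alpha> (s + 1)"
      using M.\<beta>_iff_if_pred_missing[OF M_miss \<open>4 \<le> n\<close>] degs tight that by simp
    then show ?thesis unfolding M.\<alpha>_def M.\<beta>_def \<alpha>_def unfolding R'_def
      using that by (simp add: numeral_3_eq_3)
  qed
  \<comment> \<open>After the rotation the last vertex is \<open>0\<close>, so this is the count for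
    the path from \<open>1\<close> to \<open>n - 1\<close> that omits \<open>0\<close>.\<close>
  have c2: "R 1 (j + 1) \<longleftrightarrow> \<not> \<beta> j" if "1 \<le> j" "j \<le> n - 2" for j
  proof -
    have "R' 0 j \<longleftrightarrow> \<not> R' (n - 2) (j - 1)"
      by (rule M.tight_omit_last) (use M.cyc_omit_last M_miss degs tight that in auto)
    then show ?thesis unfolding \<beta>_def unfolding R'_def
      using that n_ge by (simp add: numeral_2_eq_2 Suc_diff_Suc)
  qed
  have "\<alpha> 2"
    using c2[of 1] step[of 1] \<beta>_iff[of 1] \<open>4 \<le> n\<close> by (simp add: numeral_2_eq_2)
  have rec: "\<alpha> (s + 3) \<longleftrightarrow> \<not> \<alpha> s" if "s + 3 \<le> n - 2" for s
    using c1[of s] c2[of "s + 2"] \<beta>_iff[of "s + 2"] that by (simp add: numeral_3_eq_3)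
  show "\<alpha> s \<longleftrightarrow> even s" if "s \<le> n - 2" for s
    using that
  proof (induction s rule: less_induct)
    case (less s)
    consider "s = 0" | "s = 1" | "s = 2" | "3 \<le> s" by linarith
    then show ?case
    proof cases
      case 4
      then have "\<alpha> s \<longleftrightarrow> \<not> \<alpha> (s - 3)" using rec[of "s - 3"] less.prems by simp
      also have "\<dots> \<longleftrightarrow> even s" using less 4 by simp
      finally show ?thesis .
    qed (use ends not_\<alpha>_1_if_pred_missing[OF miss \<open>4 \<le> n\<close> tight(1)] \<open>\<alpha> 2\<close> in auto)
  qed
qed fact

text \<open>Here the vertex \<open>1\<close> may have small degree and is omitted instead: the path
  from \<open>2\<close> around to \<open>0\<close> has ends of degree sum at least \<open>n\<close>.
  Every cycle built below omits a single vertex.\<close>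

lemma alternating_if_pred_missing_2:
  assumes miss: "\<not> cyc (n - 1)" and "even n" "8 \<le> n"
    and deg: "2 * deg 0 = n" "2 * deg (n - 1) = n" "n \<le> 2 * deg 2"
  shows alternating
proof (rule alternatingI)
  have "4 \<le> n" and tight: "n \<le> deg 0 + deg (n - 1)" using deg \<open>8 \<le> n\<close> by linarith+
  note \<beta>_iff = \<beta>_iff_if_pred_missing[OF miss \<open>4 \<le> n\<close> tight]
  note not_\<alpha>_1 = not_\<alpha>_1_if_pred_missing[OF miss \<open>4 \<le> n\<close> tight]
  show "\<beta> s \<longleftrightarrow> \<not> \<alpha> (s + 1)" if "s \<le> n - 3" for s using \<beta>_iff that .
  define R' where "R' = (\<lambda>i j. R ((i + 2) mod n) ((j + 2) mod n))"
  interpret M: ham_labelling n R' unfolding R'_def by (rule rotation)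
  have M_miss: "\<not> M.cyc (n - 1)" using miss cyc_rotation unfolding R'_def by blast
  have M_deg: "M.deg i = deg ((i + 2) mod n)" if "i < n" for i
    unfolding R'_def using degree_rotation[OF that] .
  have degs: "M.deg 0 = deg 2" "M.deg (n - 2) = deg 0"
  proof -
    have "n - 2 + 2 = n" using \<open>4 \<le> n\<close> by simp
    then show "M.deg 0 = deg 2" "M.deg (n - 2) = deg 0"
      using M_deg[of 0] M_deg[of "n - 2"] \<open>4 \<le> n\<close> by (simp_all add: numeral_2_eq_2)
  qed
  have c: "R 2 (s + 2) \<longleftrightarrow> \<not> \<alpha> s" if "1 \<le> s" "s \<le> n - 3" for s
  proof -
    have "R' 0 s \<longleftrightarrow> \<not> R' (n - 2) (s - 1)"
    proof (rule M.tight_omit_last)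
      show "n \<le> M.deg 0 + M.deg (n - 2)" unfolding degs using deg by linarith
    qed (use M.cyc_omit_last M_miss that in auto)
    moreover have "(0 + 2) mod n = 2" "(s + 2) mod n = s + 2" "s - 1 + 2 = Suc s" "n - 2 + 2 = n"
      "Suc s mod n = Suc s" using that \<open>8 \<le> n\<close> by simp_all
    ultimately show ?thesis unfolding \<alpha>_def unfolding R'_def by (simp only: mod_self)
  qed
  \<comment> \<open>If \<open>\<alpha> 2\<close> fails, then \<open>\<beta> 1\<close> holds. Then
    \<open>gap\<close> forbids \<alpha> at two indices at distance two, while \<open>mono\<close>
    propagates it upwards, so \<alpha> can hold only at \<open>0\<close>, \<open>n - 3\<close> and
    \<open>n - 2\<close>. That is too few, as \<open>deg 0\<close> is at least
    \<open>4\<close>.\<close>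
  have "\<alpha> 2"
  proof (rule ccontr)
    assume "\<not> \<alpha> 2"
    then have "\<beta> 1" using \<beta>_iff[of 1] \<open>8 \<le> n\<close> by (simp add: numeral_2_eq_2)
    have gap: "\<not> \<alpha> s" if "s + 2 \<le> n - 2" "\<alpha> (s + 2)" for s
    proof
      assume "\<alpha> s"
      with that \<open>\<beta> 1\<close> have "cyc (n - 1)" unfolding \<alpha>_def \<beta>_def
        by (intro cycI[of "0 # [s + 3..<n] @ [1..<s + 2]"])
          (use n_ge sym in \<open>auto simp: path_simps numeral_3_eq_3 simp del: upt_Suc\<close>)
      then show False using miss by simp
    qed
    have mono: "\<alpha> (s + 1)" if "1 \<le> s" "s \<le> n - 4" "\<alpha> s" for s
    proof (rule ccontr)
      assume "\<not> \<alpha> (s + 1)"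
      then have "R 2 (s + 3)" using c[of "s + 1"] that by (simp add: numeral_3_eq_3)
      then have "cyc (n - 1)" using that \<open>\<beta> 1\<close> \<open>8 \<le> n\<close> step[of 0] unfolding \<alpha>_def \<beta>_def
        by (intro cycI[of "[2..<s + 2] @ [0, 1] @ rev [s + 3..<n]"])
          (use sym in \<open>auto simp: path_simps simp del: upt_Suc\<close>)
      then show False using miss by simp
    qed
    have "\<not> \<alpha> s" if "1 \<le> s" "s \<le> n - 4" for s
    proof
      assume "\<alpha> s"
      show False
      proof (cases "s = n - 4")
        case True
        then have "s + 2 = n - 2" using \<open>8 \<le> n\<close> by simp
        with gap[of s] ends(2) \<open>\<alpha> s\<close> show False by simp
      next
        case False
        then have "s + 1 \<le> n - 4" "s + 2 \<le> n - 2" using that by auto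
        moreover from this have "\<alpha> (s + 1 + 1)" using mono[of s] mono[of "s + 1"] \<open>\<alpha> s\<close> that by simp
        ultimately show False using gap[of s] \<open>\<alpha> s\<close> by simp
      qed
    qed
    then have "s = 0 \<or> n - 4 < s" if "\<alpha> s" for s
      using that by (metis One_nat_def Suc_leI gr0I not_le)
    then have "{s \<in> {..n - 2}. \<alpha> s} \<subseteq> {0, n - 3, n - 2}" by fastforce
    then have "card {s \<in> {..n - 2}. \<alpha> s} \<le> card {0, n - 3, n - 2}" by (intro card_mono) auto
    also have "\<dots> \<le> 3" by (simp add: card_insert_if)
    finally have "deg 0 \<le> 3" unfolding deg_0 by (simp add: of_bool_def sum.If_cases Int_def)
    then show False using deg \<open>8 \<le> n\<close> by simp
  qed
  \<comment> \<open>Otherwise the chord from \<open>0\<close> to \<open>3\<close>, which is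
    \<open>\<alpha> 2\<close>, closes a cycle omitting only \<open>s + 1\<close>.\<close>
  have dense: "\<alpha> s \<or> \<alpha> (s + 1)" if "3 \<le> s" "s \<le> n - 3" for s
  proof (rule ccontr)
    assume "\<not> (\<alpha> s \<or> \<alpha> (s + 1))"
    then have "R 2 (s + 2)" "\<beta> s" using c[of s] \<beta>_iff[of s] that by auto
    then have "cyc (n - 1)" using that \<open>\<alpha> 2\<close> \<open>8 \<le> n\<close> step[of 0] step[of 1] unfolding \<alpha>_def \<beta>_def
      by (intro cycI[of "[0, 1, 2] @ [s + 2..<n] @ rev [3..<s + 1]"])
        (use sym in \<open>auto simp: path_simps numeral_2_eq_2 numeral_3_eq_3 simp del: upt_Suc\<close>)
    then show False using miss by simp
  qed
  define x :: "nat \<Rightarrow> nat" where "x = (\<lambda>s. of_bool (\<alpha> s))"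
  define h where "h = (n - 2) div 2"
  have h: "n - 2 = 2 * h" using \<open>even n\<close> by (simp add: h_def)
  \<comment> \<open>Besides \<open>\<alpha> 0\<close> there are \<open>h\<close> chords for the
    \<open>h\<close> index pairs \<open>2 * i + 1\<close>, \<open>2 * i + 2\<close>. Each pair has
    at least one by \<open>dense\<close>, or by \<open>\<alpha> 2\<close> for the first, hence
    exactly one.\<close>
  have pair_sum: "(\<Sum>s\<le>2 * h. f s) = f 0 + (\<Sum>i<h. f (2 * i + 1) + f (2 * i + 2))" for h and f :: "nat \<Rightarrow> nat"
    by (induction h) (simp_all add: add_ac)
  have "deg 0 = x 0 + (\<Sum>i<h. x (2 * i + 1) + x (2 * i + 2))"
    unfolding deg_0 h x_def by (rule pair_sum)
  then have sum_h: "(\<Sum>i<h. x (2 * i + 1) + x (2 * i + 2)) = h"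
    using deg h ends(1) by (simp add: x_def)
  have ge1: "1 \<le> x (2 * i + 1) + x (2 * i + 2)" if "i < h" for i
    using dense[of "2 * i + 1"] that h \<open>\<alpha> 2\<close> \<open>8 \<le> n\<close> by (cases i) (auto simp: x_def numeral_2_eq_2)
  have one: "x (2 * i + 1) + x (2 * i + 2) = 1" if "i < h" for i
  proof (rule ccontr)
    assume "x (2 * i + 1) + x (2 * i + 2) \<noteq> 1"
    then have "1 < x (2 * i + 1) + x (2 * i + 2)" using ge1[OF that] by linarith
    then have "\<exists>i\<in>{..<h}. 1 < x (2 * i + 1) + x (2 * i + 2)" using that by blast
    then have "(\<Sum>i<h. 1) < (\<Sum>i<h. x (2 * i + 1) + x (2 * i + 2))"
      using ge1 by (intro sum_strict_mono_ex1) auto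
    then show False using sum_h by simp
  qed
  \<comment> \<open>Downwards from \<open>\<alpha> (2 * h)\<close>: the odd member of a pair fails
    once the even one holds, and \<open>dense\<close> then gives the next lower even index.\<close>
  have even: "\<alpha> (2 * i)" if "i \<le> h" for i
    using that
  proof (induction rule: inc_induct)
    case base
    show ?case using ends(2) h by simp
  next
    case (step i)
    then have "\<not> \<alpha> (2 * i + 1)" using one[of i] by (auto simp: x_def)
    then show ?case using dense[of "2 * i"] step ends(1) \<open>\<alpha> 2\<close> h
      by (cases "i = 0 \<or> i = 1") auto
  qed
  have odd: "\<not> \<alpha> (2 * i + 1)" if "i < h" for i
    using one[OF that] even[of "Suc i"] that by (auto simp: x_def)
  show "\<alpha> s \<longleftrightarrow> even s" if "s \<le> n - 2" for s
  proof (cases "even s")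
    case True
    then obtain i where "s = 2 * i" by blast
    then show ?thesis using even[of i] that h by simp
  next
    case False
    then obtain i where i: "s = 2 * i + 1" by (rule oddE)
    then have "i < h" using that h by linarith
    then show ?thesis using odd i by simp
  qed
qed fact

section \<open>The degree condition on a Hamiltonian cycle\<close>

text \<open>Only \<open>n / 2\<close> labels have parity opposite to \<open>x\<close>, so a vertex
  of larger degree has a neighbour in its own parity class.\<close>

lemma alternating_pancyclic_if_high:
  assumes alternating "x < n" "n < 2 * deg x" "3 \<le> l" "l \<le> n"
  shows "cyc l"
proof -
  obtain h where h: "n = 2 * h" using assms(1) by (auto simp: alternating_def)
  have "\<exists>y<n. R x y \<and> even (x + y)"
  proof (rule ccontr)
    assume "\<not> ?thesis"
    then have "{u \<in> {..<n}. R x u} \<subseteq> {u. u < 2 * h \<and> odd (x + u)}" using h by auto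
    then have "deg x \<le> card {u. u < 2 * h \<and> odd (x + u)}"
      unfolding degree_def by (intro card_mono) auto
    then show False using card_odd_sum_le[of h x] assms(3) h by linarith
  qed
  then show ?thesis using alternating_pancyclic assms by blast
qed

abbreviation shift :: "nat \<Rightarrow> nat \<Rightarrow> nat" where "shift r i \<equiv> (i + r) mod n"

lemma shift_less: "shift r i < n"
  using n_ge by simp

lemma shift_shift: "shift r (shift t i) = shift (t + r) i"
  by (simp add: mod_add_left_eq add.assoc)

lemma shift_inj: "i < n \<Longrightarrow> j < n \<Longrightarrow> shift r i = shift r j \<Longrightarrow> i = j"
  using inj_on_add_mod by (auto dest: inj_onD)

text \<open>Otherwise the successor map injects \<open>S\<close> into its smaller
  complement.\<close>

lemma exists_consecutive:
  assumes "S \<subseteq> {..<n}" "card ({..<n} - S) < card S"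
  shows "\<exists>i\<in>S. shift 1 i \<in> S"
proof (rule ccontr)
  assume "\<not> ?thesis"
  then have "shift 1 ` S \<subseteq> {..<n} - S" using n_ge by auto
  then have "card S \<le> card ({..<n} - S)"
    by (intro card_inj_on_le[of "shift 1"] inj_on_subset[OF inj_on_add_mod assms(1)]) auto
  then show False using assms(2) by simp
qed

text \<open>Rotation by \<open>i + 1\<close> turns any consecutive pair into the ends
  \<open>n - 1\<close> and \<open>0\<close>, so results about the ends apply to it.\<close>

lemma rotation_ends:
  assumes "i < n"
  shows "degree {..<n} (\<lambda>a b. R (shift (i + 1) a) (shift (i + 1) b)) 0 = deg (shift 1 i)"
    and "degree {..<n} (\<lambda>a b. R (shift (i + 1) a) (shift (i + 1) b)) (n - 1) = deg i"
proof -
  show "degree {..<n} (\<lambda>a b. R (shift (i + 1) a) (shift (i + 1) b)) 0 = deg (shift 1 i)"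
    using degree_rotation[of 0 "i + 1"] n_ge by simp
  have "shift (i + 1) (n - 1) = i" using assms by simp
  then show "degree {..<n} (\<lambda>a b. R (shift (i + 1) a) (shift (i + 1) b)) (n - 1) = deg i"
    using degree_rotation[of "n - 1" "i + 1"] n_ge by simp
qed

lemma pancyclic_if_consecutive_deg_sum_gt:
  assumes "i < n" "n < deg i + deg (shift 1 i)" "3 \<le> l" "l \<le> n"
  shows "cyc l"
proof -
  define R' where "R' = (\<lambda>a b. R (shift (i + 1) a) (shift (i + 1) b))"
  interpret M: ham_labelling n R' unfolding R'_def by (rule rotation)
  have "n < M.deg 0 + M.deg (n - 1)"
    using rotation_ends[OF assms(1)] assms(2) by (simp only: R'_def add.commute)
  then have "M.cyc l" using M.pancyclic_if_deg_sum_gt assms by blast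
  then show ?thesis unfolding R'_def by (rule cyc_rotation)
qed

text \<open>Deleting vertex \<open>n - 1\<close>: the crossing chords at \<open>j\<close> close the remaining path to a cycle.\<close>

lemma ham_labelling_omit_last:
  assumes "4 \<le> n" "1 \<le> j" "j \<le> n - 2" "R 0 j" "R (n - 2) (j - 1)"
  defines "g \<equiv> \<lambda>k. ([j..<n - 1] @ rev [0..<j]) ! k"
  shows "ham_labelling (n - 1) (\<lambda>a b. R (g a) (g b))" "bij_betw g {..<n - 1} {..<n - 1}"
proof -
  define js where "js = [j..<n - 1] @ rev [0..<j]"
  have len: "length js = n - 1" and dist: "distinct js" and set: "set js = {..<n - 1}"
    using assms(1-3) by (auto simp: js_def)
  have path: "successively R js"
    using assms(1-5) by (auto simp: js_def path_simps numeral_2_eq_2 simp del: upt_Suc)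
  have "js \<noteq> []" using len assms(1) by auto
  have g: "g k = js ! k" for k by (simp add: g_def js_def)
  show "ham_labelling (n - 1) (\<lambda>a b. R (g a) (g b))"
  proof
    show "R (g i) (g (Suc i))" if "Suc i < n - 1" for i
      using path that len by (simp add: g successively_conv_nth)
    have "g (n - 1 - 1) = last js" "g 0 = hd js"
      using \<open>js \<noteq> []\<close> len by (simp_all add: g last_conv_nth hd_conv_nth)
    moreover have "last js = 0" "hd js = j" using assms(1-3) by (auto simp: js_def last_rev hd_append)
    ultimately show "R (g (n - 1 - 1)) (g 0)" using assms(4) by simp
  qed (use assms(1) sym irrefl in auto)
  show "bij_betw g {..<n - 1} {..<n - 1}"
    unfolding g using bij_betw_nth[OF dist] len set by simp
qed

text \<open>The low vertex between two high ones is rotated to the last place and deleted; the high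
  neighbours have degree sum above \<open>n\<close>, so the rest keeps a Hamiltonian cycle. All high
  vertices survive and are more than half of the \<open>n - 1\<close> vertices, so two of them are
  consecutive there, and deletion costs each degree at most one.\<close>

lemma pancyclic_if_high_low_alternate:
  assumes "even n" "4 \<le> n" and i: "i < n" "n < 2 * deg i" "2 * deg (shift 1 i) < n" "n < 2 * deg (shift 2 i)"
    and high: "n \<le> 2 * card {v \<in> {..<n}. n < 2 * deg v}" and l: "3 \<le> l" "l \<le> n"
  shows "cyc l"
proof (cases "l = n")
  case False
  define R' where "R' = (\<lambda>a b. R (shift (i + 2) a) (shift (i + 2) b))"
  interpret M: ham_labelling n R' unfolding R'_def by (rule rotation)
  have M_deg: "M.deg a = deg (shift (i + 2) a)" if "a < n" for a
    unfolding R'_def using degree_rotation[OF that] .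
  have e: "n - 2 + (i + 2) = i + n" "n - 1 + (i + 2) = i + 1 + n" using \<open>4 \<le> n\<close> by auto
  have sh: "shift (i + 2) 0 = shift 2 i" "shift (i + 2) (n - 2) = i" "shift (i + 2) (n - 1) = shift 1 i"
    unfolding e mod_add_self2 using \<open>i < n\<close> by simp_all
  have degs: "M.deg 0 = deg (shift 2 i)" "M.deg (n - 2) = deg i" "M.deg (n - 1) = deg (shift 1 i)"
    using M_deg[of 0] M_deg[of "n - 2"] M_deg[of "n - 1"] \<open>4 \<le> n\<close> unfolding sh by simp_all
  have "n < M.deg 0 + M.deg (n - 2)" unfolding degs using i by linarith
  then obtain j where j: "1 \<le> j" "j \<le> n - 2" "R' 0 j" "R' (n - 2) (j - 1)"
    using M.deg_omit_last_le by (meson not_le)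
  define g where "g = (\<lambda>k. ([j..<n - 1] @ rev [0..<j]) ! k)"
  define R'' where "R'' = (\<lambda>a b. R' (g a) (g b))"
  interpret Q: ham_labelling "n - 1" R''
    unfolding R''_def g_def by (rule M.ham_labelling_omit_last(1)) (use \<open>4 \<le> n\<close> j in auto)
  have g: "bij_betw g {..<n - 1} {..<n - 1}"
    unfolding g_def by (rule M.ham_labelling_omit_last(2)) (use \<open>4 \<le> n\<close> j in auto)
  then have g_less: "g a < n - 1" if "a < n - 1" for a using that by (auto simp: bij_betw_def)
  have g_surj: "\<exists>a<n - 1. b = g a" if "b < n - 1" for b
    using g that unfolding bij_betw_def by (metis imageE lessThan_iff)
  have g_inj: "inj_on g {..<n - 1}" using g by (simp add: bij_betw_def)
  have Q_deg: "M.deg (g a) \<le> Q.deg a + 1" if "a < n - 1" for a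
  proof -
    have "{u \<in> {..<n}. R' (g a) u} \<subseteq> insert (n - 1) (g ` {b \<in> {..<n - 1}. R'' a b})"
    proof
      fix u assume u: "u \<in> {u \<in> {..<n}. R' (g a) u}"
      show "u \<in> insert (n - 1) (g ` {b \<in> {..<n - 1}. R'' a b})"
      proof (cases "u = n - 1")
        case False
        then have "u < n - 1" using u by auto
        then obtain b where "b < n - 1" "u = g b" using g_surj by blast
        then show ?thesis using u unfolding R''_def by blast
      qed simp
    qed
    then have "M.deg (g a) \<le> card (insert (n - 1) (g ` {b \<in> {..<n - 1}. R'' a b}))"
      unfolding degree_def by (intro card_mono) auto
    also have "\<dots> \<le> Suc (card (g ` {b \<in> {..<n - 1}. R'' a b}))" by (rule card_insert_le_m1) simp_all
    also have "\<dots> \<le> Suc (card {b \<in> {..<n - 1}. R'' a b})" by (simp add: card_image_le)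
    finally show ?thesis by (simp add: degree_def)
  qed
  define S where "S = {a \<in> {..<n - 1}. n < 2 * M.deg (g a)}"
  have "{v \<in> {..<n}. n < 2 * deg v} \<subseteq> (\<lambda>a. shift (i + 2) (g a)) ` S"
  proof
    fix v assume v: "v \<in> {v \<in> {..<n}. n < 2 * deg v}"
    then obtain b where b: "b < n" "v = shift (i + 2) b"
      using bij_rotation[of "i + 2"] unfolding bij_betw_def by blast
    then have "b \<noteq> n - 1" using v i sh by auto
    then have "b < n - 1" using b by simp
    then obtain a where "a < n - 1" "b = g a" using g_surj by blast
    moreover from this have "a \<in> S" using v b M_deg[of b] unfolding S_def by simp
    ultimately show "v \<in> (\<lambda>a. shift (i + 2) (g a)) ` S" using b by blast
  qed
  then have "card {v \<in> {..<n}. n < 2 * deg v} \<le> card S"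
    by (rule surj_card_le[rotated]) (simp add: S_def)
  then have "n \<le> 2 * card S" using high by linarith
  moreover have "card ({..<n - 1} - S) = n - 1 - card S" by (subst card_Diff_subset) (auto simp: S_def)
  ultimately have "card ({..<n - 1} - S) < card S" using n_ge by linarith
  then obtain a where a: "a \<in> S" "Q.shift 1 a \<in> S"
    using Q.exists_consecutive[of S] by (auto simp: S_def)
  \<comment> \<open>Evenness of \<open>n\<close> supplies the margin that pays for the loss of one
    in each of the two degrees.\<close>
  have "n + 2 \<le> 2 * d" if "n < 2 * d" for d using that \<open>even n\<close> by presburger
  then have "n + 2 \<le> 2 * M.deg (g a)" "n + 2 \<le> 2 * M.deg (g (Q.shift 1 a))"
    using a unfolding S_def by blast+
  moreover have "a < n - 1" "Q.shift 1 a < n - 1" using a unfolding S_def by auto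
  ultimately have "n - 1 < Q.deg a + Q.deg (Q.shift 1 a)"
    using Q_deg[of a] Q_deg[of "Q.shift 1 a"] \<open>4 \<le> n\<close> by linarith
  then have "Q.cyc l"
    using Q.pancyclic_if_consecutive_deg_sum_gt[of a l] a l False by (auto simp: S_def)
  then have "M.cyc l"
    by (rule has_cycle_map[OF _ g_inj]) (use g_less in \<open>fastforce simp: R''_def\<close>)+
  then show ?thesis unfolding R'_def by (rule cyc_rotation)
qed (use cyc_n in simp)

text \<open>Non-low vertices outnumber low ones, so two of them are consecutive, and by
  \<open>le\<close> both have degree exactly \<open>n / 2\<close>. Any alternating pattern is ruled
  out by the high vertex \<open>x\<close>. A missing \<open>l \<le> n - 2\<close> yields such a
  pattern at once; for \<open>l = n - 1\<close> its absence yields an injection of the non-low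
  vertices into the low ones.\<close>

lemma pancyclic_if_few_low:
  assumes "even n" and few: "2 * card {v \<in> {..<n}. 2 * deg v < n} + 4 \<le> n"
    and le: "\<And>i. i < n \<Longrightarrow> deg i + deg (shift 1 i) \<le> n"
    and x: "x < n" "n < 2 * deg x" and l: "3 \<le> l" "l \<le> n"
  shows "cyc l"
proof (rule ccontr)
  assume miss: "\<not> cyc l"
  define L where "L = {v \<in> {..<n}. 2 * deg v < n}"
  define S where "S = {v \<in> {..<n}. n \<le> 2 * deg v}"
  have "{..<n} - S = L" "S \<subseteq> {..<n}" "finite L" by (auto simp: L_def S_def)
  then have "n - card S = card L" using card_Diff_subset[of S "{..<n}"] finite_subset[of S "{..<n}"] by simp
  then have card_S: "card L < card S" using few by (simp add: L_def)

  \<comment> \<open>Both cycle neighbours of the high vertex \<open>x\<close> are low and they are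
    distinct; two low vertices and \<open>few\<close> give the bound.\<close>
  have "8 \<le> n"
  proof -
    have pred: "shift 1 (shift (n - 1) x) = x" unfolding shift_shift using x(1) n_ge by simp
    have "deg (shift (n - 1) x) + deg x \<le> n" using le[of "shift (n - 1) x"] shift_less pred by metis
    then have "{shift 1 x, shift (n - 1) x} \<subseteq> L"
      using x le[OF x(1)] n_ge by (auto simp: L_def)
    moreover have "shift 1 x \<noteq> shift (n - 1) x"
    proof
      assume "shift 1 x = shift (n - 1) x"
      then have "shift 1 (shift 1 x) = x" using pred by (simp only:)
      then have "shift 2 x = x" by (simp only: shift_shift one_add_one)
      then have "x + 2 = x \<or> x + 2 = x + n" using x(1) n_ge by (cases "x + 2 < n") (auto simp: mod_if split: if_splits)
      then show False using n_ge by simp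
    qed
    ultimately have "2 \<le> card L" using card_mono[OF \<open>finite L\<close>, of "{shift 1 x, shift (n - 1) x}"] by simp
    then show ?thesis using few by (simp add: L_def)
  qed

  have no_alternating: "\<not> ham_labelling.alternating n (\<lambda>a b. R (shift r a) (shift r b))" for r
  proof
    define R' where "R' = (\<lambda>a b. R (shift r a) (shift r b))"
    interpret M: ham_labelling n R' unfolding R'_def by (rule rotation)
    assume "ham_labelling.alternating n (\<lambda>a b. R (shift r a) (shift r b))"
    then have alt: M.alternating by (simp only: R'_def)
    obtain y where y: "y < n" "x = shift r y"
      using bij_rotation[of r] x(1) unfolding bij_betw_def by blast
    then have "M.deg y = deg x" unfolding R'_def using degree_rotation[of y r] by simp
    then have "M.cyc l" using M.alternating_pancyclic_if_high[OF alt y(1)] x l by simp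
    then show False using cyc_rotation miss unfolding R'_def by blast
  qed

  have tight: "2 * deg i = n \<and> 2 * deg (shift 1 i) = n" if "i \<in> S" "shift 1 i \<in> S" for i
    using le[of i] that unfolding S_def by auto

  show False
  proof (cases "l \<le> n - 2")
    case True
    obtain i where i: "i \<in> S" "shift 1 i \<in> S"
      using exists_consecutive[of S] card_S \<open>{..<n} - S = L\<close> \<open>S \<subseteq> {..<n}\<close> by metis
    then have "i < n" by (simp add: S_def)
    define R' where "R' = (\<lambda>a b. R (shift (i + 1) a) (shift (i + 1) b))"
    interpret M: ham_labelling n R' unfolding R'_def by (rule rotation)
    have "n \<le> M.deg 0 + M.deg (n - 1)"
      using rotation_ends[OF \<open>i < n\<close>] tight[OF i] unfolding R'_def by linarith
    moreover have "\<not> M.cyc l" using cyc_rotation miss unfolding R'_def by blast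
    ultimately have "M.alternating" using M.alternating_if_cycle_missing True l by blast
    then show False using no_alternating unfolding R'_def by blast
  next
    case False
    moreover have "l \<noteq> n" using miss cyc_n by blast
    ultimately have "l = n - 1" using l by linarith
    have low: "shift 2 i \<in> L \<and> shift 3 i \<in> L" if i: "i \<in> S" "shift 1 i \<in> S" for i
    proof (rule ccontr)
      assume "\<not> (shift 2 i \<in> L \<and> shift 3 i \<in> L)"
      then have not_low: "n \<le> 2 * deg (shift 2 i) \<or> n \<le> 2 * deg (shift 3 i)"
        using shift_less[of i 2] shift_less[of i 3]
        unfolding L_def mem_Collect_eq lessThan_iff not_less[symmetric] by blast
      have "i < n" using i by (simp add: S_def)
      define R' where "R' = (\<lambda>a b. R (shift (i + 1) a) (shift (i + 1) b))"
      interpret M: ham_labelling n R' unfolding R'_def by (rule rotation)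
      have ends: "M.deg 0 = deg (shift 1 i)" "M.deg (n - 1) = deg i"
        using rotation_ends[OF \<open>i < n\<close>] unfolding R'_def by blast+
      have "1 + (i + 1) = i + 2" "2 + (i + 1) = i + 3" by simp_all
      then have inner: "M.deg 1 = deg (shift 2 i)" "M.deg 2 = deg (shift 3 i)"
        using degree_rotation[of 1 "i + 1"] degree_rotation[of 2 "i + 1"] \<open>8 \<le> n\<close>
        unfolding R'_def by (simp_all only:)
      have M_miss: "\<not> M.cyc (n - 1)" using cyc_rotation miss \<open>l = n - 1\<close> unfolding R'_def by blast
      have M_deg: "2 * M.deg 0 = n" "2 * M.deg (n - 1) = n" using tight[OF i] ends by auto
      from not_low have "M.alternating"
      proof
        assume "n \<le> 2 * deg (shift 2 i)"
        then have "n \<le> M.deg 0 + M.deg (n - 1)" "n \<le> M.deg 0 + M.deg 1" "n \<le> M.deg 1 + M.deg (n - 1)"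
          using M_deg inner by linarith+
        then show ?thesis using M.alternating_if_pred_missing_1 M_miss \<open>even n\<close> \<open>8 \<le> n\<close> by simp
      next
        assume "n \<le> 2 * deg (shift 3 i)"
        then have "n \<le> 2 * M.deg 2" using inner by simp
        then show ?thesis using M.alternating_if_pred_missing_2 M_miss \<open>even n\<close> \<open>8 \<le> n\<close> M_deg by blast
      qed
      then show False using no_alternating unfolding R'_def by blast
    qed
    txt \<open>The second vertex of a non-low pair is sent to the first of the two low vertices behind the
      pair, and the first vertex to the second one.\<close>
    define f where "f = (\<lambda>i. if shift 1 i \<in> L then shift 1 i else shift 3 i)"
    have S_or_L: "shift r i \<in> S \<or> shift r i \<in> L" for r i
      using shift_less \<open>{..<n} - S = L\<close> by blast
    have disj: "i \<notin> L" if "i \<in> S" for i using that \<open>{..<n} - S = L\<close> by blast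
    have less: "i < n" if "i \<in> S" for i using that by (simp add: S_def)
    have "f ` S \<subseteq> L" using low S_or_L by (fastforce simp: f_def)
    moreover have "inj_on f S"
    proof (rule inj_onI)
      \<comment> \<open>A collision of the two branches of \<open>f\<close> would place
        \<open>i\<close> two steps behind the first vertex \<open>j\<close> of a non-low pair, where
        \<open>low\<close> allows only low vertices.\<close>
      have aux: False if ij: "i \<in> S" "j \<in> S" "shift 1 i \<in> L" "shift 1 j \<notin> L" "shift 1 i = shift 3 j" for i j
      proof -
        have "(2::nat) + 1 = 3" by simp
        then have "shift 1 i = shift 1 (shift 2 j)" using ij(5) by (simp only: shift_shift)
        then have "i = shift 2 j" using shift_inj less ij(1) shift_less by blast
        have "shift 1 j \<in> S" using ij(4) S_or_L[of j 1] by simp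
        then have "shift 2 j \<in> L" using low[OF ij(2)] by simp
        then show False using \<open>i = shift 2 j\<close> disj[OF ij(1)] by simp
      qed
      fix i j assume "i \<in> S" "j \<in> S" "f i = f j"
      then show "i = j"
        using aux[of i j] aux[of j i] shift_inj[of i j 1] shift_inj[of i j 3] less[of i] less[of j]
        unfolding f_def by (metis (full_types))
    qed
    ultimately have "card S \<le> card L" using card_inj_on_le \<open>finite L\<close> by blast
    then show False using card_S by simp
  qed
qed

text \<open>If no consecutive pair has degree sum above \<open>n\<close>, successors of high
  vertices are low, so \<open>card H \<le> card L\<close>. The condition at the largest index
  \<open>h\<close> below \<open>n / 2\<close> bounds \<open>card H\<close> from below: for odd
  \<open>n\<close> this exceeds the total, and for even \<open>n\<close> with
  \<open>h \<le> card L\<close> it forces both classes to have \<open>n / 2\<close>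
  elements.\<close>

theorem pancyclic_if_chvatal_condition:
  assumes chv: "\<And>i. 1 \<le> i \<Longrightarrow> 2 * i < n \<Longrightarrow> i \<le> card {v \<in> {..<n}. deg v \<le> i} \<Longrightarrow>
      i + 1 \<le> card {v \<in> {..<n}. n - i \<le> deg v}"
    and high: "even n \<Longrightarrow> \<exists>v<n. n < 2 * deg v" and l: "3 \<le> l" "l \<le> n"
  shows "cyc l"
proof (cases "\<exists>i<n. n < deg i + deg (shift 1 i)")
  case True
  then show ?thesis using pancyclic_if_consecutive_deg_sum_gt l by blast
next
  case False
  then have le: "deg i + deg (shift 1 i) \<le> n" if "i < n" for i using that by (meson not_le)
  define H where "H = {v \<in> {..<n}. n < 2 * deg v}"
  define L where "L = {v \<in> {..<n}. 2 * deg v < n}"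
  have fin: "finite H" "finite L" by (simp_all add: H_def L_def)
  have succ_H: "shift 1 i \<in> L" if "i \<in> H" for i
    using le[of i] that n_ge by (auto simp: H_def L_def)
  have inj: "inj_on (shift 1) H" by (rule inj_on_subset[OF inj_on_add_mod]) (auto simp: H_def)
  have HL: "card H \<le> card L" using card_inj_on_le[OF inj _ fin(2)] succ_H by blast
  have "H \<inter> L = {}" by (auto simp: H_def L_def)
  then have card_Un: "card (H \<union> L) = card H + card L" using fin by (rule card_Un_disjoint[rotated 2])
  show ?thesis
  proof (cases "even n")
    case False
    then have "H \<union> L = {..<n}" by (auto simp: H_def L_def) presburger
    then have total: "card H + card L = n" using card_Un by simp
    define h where "h = n div 2"
    have h: "n = 2 * h + 1" "1 \<le> h" using False n_ge by (auto simp: h_def)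
    then have "L = {v \<in> {..<n}. deg v \<le> h}" "H = {v \<in> {..<n}. n - h \<le> deg v}"
      by (auto simp: L_def H_def)
    then have "h \<le> card L \<Longrightarrow> h + 1 \<le> card H" using chv[of h] h by simp
    then show ?thesis using total HL h by linarith
  next
    case True
    define h where "h = n div 2 - 1"
    have h: "n = 2 * h + 2" "1 \<le> h" using True n_ge by (auto simp: h_def elim!: evenE)
    then have L: "L = {v \<in> {..<n}. deg v \<le> h}" and H: "H = {v \<in> {..<n}. n - h \<le> deg v}"
      by (auto simp: L_def H_def)
    obtain x where x: "x < n" "n < 2 * deg x" using high True by blast
    show ?thesis
    proof (cases "h \<le> card L")
      case False
      then have "2 * card L + 4 \<le> n" using h by linarith
      then show ?thesis using pancyclic_if_few_low[OF True _ le x l] by (simp add: L_def)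
    next
      case True
      then have "h + 1 \<le> card H" using chv[of h] h L H by simp
      moreover have "card (H \<union> L) \<le> n" using card_mono[of "{..<n}" "H \<union> L"] by (auto simp: H_def L_def)
      ultimately have cards: "card H = h + 1" "card L = h + 1" using HL card_Un h by linarith+
      then have "shift 1 ` H = L"
        by (intro card_subset_eq) (use fin succ_H card_image[OF inj] in auto)
      have "H \<union> L = {..<n}" by (rule card_subset_eq) (use card_Un cards h in \<open>auto simp: H_def L_def\<close>)
      have "x \<in> H" using x by (simp add: H_def)
      \<comment> \<open>Every low vertex is the successor of a high one, but the predecessor of
        \<open>shift 2 x\<close> is the low vertex \<open>shift 1 x\<close>.\<close>
      have "shift 2 x \<notin> L"
      proof
        assume "shift 2 x \<in> L"
        then obtain j where j: "j \<in> H" "shift 2 x = shift 1 j" using \<open>shift 1 ` H = L\<close> by blast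
        then have "shift 1 (shift 1 x) = shift 1 j" by (simp only: shift_shift one_add_one)
        then have "shift 1 x = j" using shift_inj[of "shift 1 x" j 1] j shift_less[of x 1] by (simp add: H_def)
        then show False using succ_H[OF \<open>x \<in> H\<close>] j \<open>H \<inter> L = {}\<close> by blast
      qed
      then have "shift 2 x \<in> H" using \<open>H \<union> L = {..<n}\<close> shift_less by blast
      show ?thesis
        by (rule pancyclic_if_high_low_alternate[of x])
          (use \<open>even n\<close> h x succ_H[OF \<open>x \<in> H\<close>] \<open>shift 2 x \<in> H\<close> cards l in \<open>auto simp: H_def L_def\<close>)
    qed
  qed
qed

end

section \<open>Hamiltonicity\<close>

text \<open>The sets \<open>?A\<close> and \<open>?B\<close> have at least \<open>n\<close> elements
  in total inside the \<open>n - 1\<close> positions \<open>{1..<n}\<close>, so they share some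
  \<open>j\<close>; the path then closes as \<open>j..n - 1\<close>, \<open>j - 1\<close> down to
  \<open>0\<close>.\<close>

lemma hamiltonian_if_crossing:
  assumes n: "2 \<le> n" and sym: "\<And>i j. R i j \<Longrightarrow> R j i" and irrefl: "\<And>i. \<not> R i i"
    and step: "\<And>i. Suc i < n \<Longrightarrow> R i (Suc i)"
    and deg: "n \<le> degree {..<n} R 0 + degree {..<n} R (n - 1)"
  shows "has_cycle {..<n} R n"
proof -
  let ?A = "{j \<in> {1..<n}. R 0 j}" and ?B = "{j \<in> {1..<n}. R (n - 1) (j - 1)}"
  have "{u \<in> {..<n}. R 0 u} = ?A"
    using irrefl[of 0] by (metis (mono_tags, lifting) atLeastLessThan_iff lessThan_iff less_one not_le)
  then have A: "degree {..<n} R 0 = card ?A" by (simp add: degree_def)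
  have "Suc ` {u \<in> {..<n}. R (n - 1) u} \<subseteq> ?B"
  proof
    fix j assume "j \<in> Suc ` {u \<in> {..<n}. R (n - 1) u}"
    then obtain u where u: "j = Suc u" "u < n" "R (n - 1) u" by auto
    then have "u \<noteq> n - 1" using irrefl by blast
    then show "j \<in> ?B" using u by auto
  qed
  then have "card (Suc ` {u \<in> {..<n}. R (n - 1) u}) \<le> card ?B" by (intro card_mono) auto
  then have B: "degree {..<n} R (n - 1) \<le> card ?B" by (simp add: degree_def card_image)
  have "?A \<inter> ?B \<noteq> {}"
  proof
    assume "?A \<inter> ?B = {}"
    then have "card (?A \<union> ?B) = card ?A + card ?B" by (intro card_Un_disjoint) auto
    moreover have "card (?A \<union> ?B) \<le> card {1..<n}" by (intro card_mono) auto
    ultimately show False using A B deg n unfolding card_atLeastLessThan by linarith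
  qed
  then obtain j where j: "1 \<le> j" "j < n" "R 0 j" "R (n - 1) (j - 1)" by auto
  have up: "successively R [a..<b]" if "b \<le> n" for a b
    using that by (auto simp: successively_conv_nth intro!: step)
  have "successively (\<lambda>i j. R j i) [0..<j]"
    by (rule successively_mono[OF up]) (use j sym in auto)
  then have "has_cycle {..<n} R (length ([j..<n] @ rev [0..<j]))"
    by (intro has_cycleI)
      (use j up sym in \<open>auto simp: successively_append_iff hd_rev last_rev hd_append last_append\<close>)
  then show ?thesis using j by simp
qed

lemma degree_relabel:
  assumes "bij_betw v {..<n} V" "i < n"
  shows "degree {..<n} (\<lambda>i j. E (v i) (v j)) i = degree V E (v i)"
proof -
  have "v ` {j \<in> {..<n}. E (v i) (v j)} = {u \<in> V. E (v i) u}"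
    using assms(1) unfolding bij_betw_def by auto
  moreover have "inj_on v {j \<in> {..<n}. E (v i) (v j)}"
    using assms(1) unfolding bij_betw_def by (auto intro: inj_on_subset)
  then have "card (v ` {j \<in> {..<n}. E (v i) (v j)}) = card {j \<in> {..<n}. E (v i) (v j)}"
    by (rule card_image)
  ultimately show ?thesis by (simp add: degree_def)
qed

lemma ham_labelling_if_has_cycle:
  assumes G: "simple_graph V E" and "card V = n" "3 \<le> n" and cycle: "has_cycle V E n"
  obtains v where "bij_betw v {..<n} V" "ham_labelling n (\<lambda>i j. E (v i) (v j))"
proof -
  obtain xs where xs: "length xs = n" "distinct xs" "set xs \<subseteq> V"
    "\<And>j. j < n \<Longrightarrow> E (xs ! j) (xs ! ((j + 1) mod n))"
    using cycle unfolding has_cycle_def by blast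
  have "set xs = V"
    by (rule card_subset_eq) (use G xs assms(2) distinct_card[of xs] in \<open>auto simp: simple_graph_def\<close>)
  then have "bij_betw ((!) xs) {..<n} V" using bij_betw_nth[OF xs(2)] xs(1) by simp
  moreover have "ham_labelling n (\<lambda>i j. E (xs ! i) (xs ! j))"
  proof
    show "E (xs ! i) (xs ! Suc i)" if "Suc i < n" for i using xs(4)[of i] that by simp
    show "E (xs ! (n - 1)) (xs ! 0)" using xs(4)[of "n - 1"] \<open>3 \<le> n\<close> by simp
  qed (use G \<open>3 \<le> n\<close> in \<open>auto simp: simple_graph_def\<close>)
  ultimately show thesis by (rule that)
qed

section \<open>Adding edges and Chvatal's theorem\<close>

definition add_edge :: "('a \<Rightarrow> 'a \<Rightarrow> bool) \<Rightarrow> 'a \<Rightarrow> 'a \<Rightarrow> 'a \<Rightarrow> 'a \<Rightarrow> bool" where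
  "add_edge E u w x y \<longleftrightarrow> E x y \<or> (x = u \<and> y = w) \<or> (x = w \<and> y = u)"

lemma simple_graph_add_edge:
  "simple_graph V E \<Longrightarrow> u \<in> V \<Longrightarrow> w \<in> V \<Longrightarrow> u \<noteq> w \<Longrightarrow> simple_graph V (add_edge E u w)"
  by (auto simp: simple_graph_def add_edge_def)

text \<open>The closure step of Bondy and Chvatal. A cycle avoiding the new edge survives; otherwise
  it is rotated so that the new edge joins the last vertex to the first, and the remaining
  Hamiltonian path has crossing chords.\<close>

lemma hamiltonian_if_add_edge_hamiltonian:
  assumes G: "simple_graph V E" and uw: "u \<in> V" "w \<in> V" "u \<noteq> w" and "card V = n" "3 \<le> n"
    and deg: "n \<le> degree V E u + degree V E w" and cycle: "has_cycle V (add_edge E u w) n"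
  shows "has_cycle V E n"
proof -
  have E: "\<And>x y. E x y \<Longrightarrow> E y x" "\<And>x. \<not> E x x" using G by (auto simp: simple_graph_def)
  obtain v where bij: "bij_betw v {..<n} V" and lab: "ham_labelling n (\<lambda>i j. add_edge E u w (v i) (v j))"
    using ham_labelling_if_has_cycle[OF simple_graph_add_edge[OF G uw] assms(5,6) cycle] .
  interpret ham_labelling n "\<lambda>i j. add_edge E u w (v i) (v j)" by (rule lab)
  have inj: "inj_on v {..<n}" and range: "v ` {..<n} = V" using bij by (auto simp: bij_betw_def)
  show ?thesis
  proof (cases "\<exists>i<n. {v i, v (shift 1 i)} = {u, w}")
    case False
    show ?thesis
      unfolding has_cycle_def
    proof (intro exI[of _ "map v [0..<n]"] conjI allI impI)
      show "distinct (map v [0..<n])" using inj by (simp add: distinct_map atLeast0LessThan)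
      show "set (map v [0..<n]) \<subseteq> V" using range by (auto simp: atLeast0LessThan)
      fix j assume j: "j < n"
      then have "add_edge E u w (v j) (v (shift 1 j))"
        using step[of j] close by (cases "Suc j < n") (auto simp: not_less le_Suc_eq mod_if)
      then have "E (v j) (v (shift 1 j))" using False j unfolding add_edge_def by blast
      then show "E (map v [0..<n] ! j) (map v [0..<n] ! ((j + 1) mod n))" using j by simp
    qed simp
  next
    case True
    then obtain i where i: "i < n" "{v i, v (shift 1 i)} = {u, w}" by blast
    define g where "g = (\<lambda>a. v (shift (i + 1) a))"
    have g_bij: "bij_betw g {..<n} V"
      using bij_betw_trans[OF bij_rotation bij] unfolding g_def comp_def .
    interpret M: ham_labelling n "\<lambda>a b. add_edge E u w (g a) (g b)"
      unfolding g_def by (rule rotation)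
    have "shift (i + 1) (n - 1) = i" "shift (i + 1) 0 = shift 1 i" using i by simp_all
    then have ends: "{g 0, g (n - 1)} = {u, w}" using i unfolding g_def by (simp add: insert_commute)
    have "has_cycle {..<n} (\<lambda>a b. E (g a) (g b)) n"
    proof (rule hamiltonian_if_crossing)
      show "E (g a) (g (Suc a))" if "Suc a < n" for a
      proof -
        have "{a, Suc a} \<noteq> {0, n - 1}" using that \<open>3 \<le> n\<close> by (auto simp: doubleton_eq_iff)
        moreover have "inj_on g {..<n}" using g_bij by (simp add: bij_betw_def)
        ultimately have "g ` {a, Suc a} \<noteq> g ` {0, n - 1}"
          using that \<open>3 \<le> n\<close> by (subst inj_on_image_eq_iff[of g "{..<n}"]) auto
        then have "{g a, g (Suc a)} \<noteq> {u, w}" using ends by simp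
        then show ?thesis using M.step[OF that] unfolding add_edge_def by blast
      qed
      have "degree V E (g 0) + degree V E (g (n - 1)) = degree V E u + degree V E w"
        using ends by (auto simp: doubleton_eq_iff)
      then show "n \<le> degree {..<n} (\<lambda>a b. E (g a) (g b)) 0 + degree {..<n} (\<lambda>a b. E (g a) (g b)) (n - 1)"
        using degree_relabel[OF g_bij, of _ E] deg \<open>3 \<le> n\<close> by simp
    qed (use E \<open>3 \<le> n\<close> in auto)
    then show ?thesis
      by (rule has_cycle_map[where f = g]) (use g_bij in \<open>auto simp: bij_betw_def\<close>)
  qed
qed

lemma complete_graph_hamiltonian:
  assumes "finite V" "card V = n" "2 \<le> n" "\<And>x y. x \<in> V \<Longrightarrow> y \<in> V \<Longrightarrow> x \<noteq> y \<Longrightarrow> E x y"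
  shows "has_cycle V E n"
proof -
  obtain xs where xs: "set xs = V" "distinct xs" using finite_distinct_list[OF assms(1)] by blast
  then have len: "length xs = n" using distinct_card assms(2) by fastforce
  show ?thesis
    unfolding has_cycle_def
  proof (intro exI[of _ xs] conjI allI impI)
    fix j assume j: "j < n"
    then have "(j + 1) mod n < n" "(j + 1) mod n \<noteq> j"
      using assms(3) by (auto simp: mod_if)
    then show "E (xs ! j) (xs ! ((j + 1) mod n))"
      using assms(4) xs len j by (metis nth_eq_iff_index_eq nth_mem)
  qed (use xs len in auto)
qed

text \<open>The degree condition is in counting form and survives the addition of edges. Induction
  on the number of nonadjacent pairs: join the nonadjacent \<open>u\<close>, \<open>w\<close> of
  maximal degree sum. If that sum is at least \<open>n\<close>, the closure step applies; otherwise
  the condition produces a nonadjacent pair with a larger sum.\<close>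

theorem chvatal_hamiltonian:
  assumes "simple_graph V E" "card V = n" "3 \<le> n"
    and "\<And>i. 1 \<le> i \<Longrightarrow> 2 * i < n \<Longrightarrow> i \<le> card {v \<in> V. degree V E v \<le> i} \<Longrightarrow>
      i + 1 \<le> card {v \<in> V. n - i \<le> degree V E v}"
  shows "has_cycle V E n"
  using assms
proof (induction "card {(x, y). x \<in> V \<and> y \<in> V \<and> \<not> E x y}" arbitrary: E rule: less_induct)
  case less
  note G = less.prems(1) and chv = less.prems(4)
  have fin: "finite V" and E: "\<And>x y. E x y \<Longrightarrow> E y x" "\<And>x. \<not> E x x" "\<And>x y. E x y \<Longrightarrow> x \<in> V \<and> y \<in> V"
    using G by (auto simp: simple_graph_def)
  let ?d = "degree V E"
  let ?P = "\<lambda>p. fst p \<in> V \<and> snd p \<in> V \<and> fst p \<noteq> snd p \<and> \<not> E (fst p) (snd p)"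
  let ?f = "\<lambda>p. ?d (fst p) + ?d (snd p)"
  show ?case
  proof (cases "\<exists>p. ?P p")
    case False
    then have "E x y" if "x \<in> V" "y \<in> V" "x \<noteq> y" for x y using that by auto
    then show ?thesis using complete_graph_hamiltonian[OF fin less.prems(2)] \<open>3 \<le> n\<close> by simp
  next
    case True
    have d_le: "?d x \<le> n" for x using card_mono[OF fin, of "{u \<in> V. E x u}"] less.prems(2) by (auto simp: degree_def)
    have "?f p < 2 * n + 1" for p using d_le[of "fst p"] d_le[of "snd p"] by linarith
    moreover obtain p0 where "?P p0" using True by blast
    ultimately have "\<exists>p. ?P p \<and> (\<forall>q. ?P q \<longrightarrow> ?f q \<le> ?f p)"
      using ex_has_greatest_nat[of ?P p0 ?f "2 * n + 1"] by blast
    then obtain p where p: "?P p" and max: "\<And>q. ?P q \<Longrightarrow> ?f q \<le> ?f p" by auto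
    obtain u w where uw: "u \<in> V" "w \<in> V" "u \<noteq> w" "\<not> E u w" "?d u \<le> ?d w" and f_p: "?f p = ?d u + ?d w"
    proof (cases "?d (fst p) \<le> ?d (snd p)")
      case True
      then show ?thesis using that[of "fst p" "snd p"] p by blast
    next
      case False
      then show ?thesis using that[of "snd p" "fst p"] p E(1)[of "snd p" "fst p"] by fastforce
    qed
    have max_uw: "?d x + ?d y \<le> ?d u + ?d w" if "x \<in> V" "y \<in> V" "x \<noteq> y" "\<not> E x y" for x y
      using max[of "(x, y)"] that f_p by simp
    let ?E = "add_edge E u w"
    have d_mono: "?d x \<le> degree V ?E x" for x
      unfolding degree_def by (rule card_mono) (use fin in \<open>auto simp: add_edge_def\<close>)
    have "has_cycle V ?E n"
    proof (rule less.hyps)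
      show "card {(x, y). x \<in> V \<and> y \<in> V \<and> \<not> ?E x y} < card {(x, y). x \<in> V \<and> y \<in> V \<and> \<not> E x y}"
      proof (rule psubset_card_mono)
        show "finite {(x, y). x \<in> V \<and> y \<in> V \<and> \<not> E x y}"
          by (rule finite_subset[of _ "V \<times> V"]) (use fin in auto)
        have "(u, w) \<in> {(x, y). x \<in> V \<and> y \<in> V \<and> \<not> E x y}" using uw by simp
        moreover have "(u, w) \<notin> {(x, y). x \<in> V \<and> y \<in> V \<and> \<not> ?E x y}" by (simp add: add_edge_def)
        ultimately show "{(x, y). x \<in> V \<and> y \<in> V \<and> \<not> ?E x y} \<subset> {(x, y). x \<in> V \<and> y \<in> V \<and> \<not> E x y}"
          by (auto simp: add_edge_def)
      qed
      show "simple_graph V ?E" by (rule simple_graph_add_edge) (use G uw in auto)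
      show "i + 1 \<le> card {v \<in> V. n - i \<le> degree V ?E v}"
        if i: "1 \<le> i" "2 * i < n" "i \<le> card {v \<in> V. degree V ?E v \<le> i}" for i
      proof -
        have "card {v \<in> V. degree V ?E v \<le> i} \<le> card {v \<in> V. ?d v \<le> i}"
          by (rule card_mono) (use fin d_mono order_trans in auto)
        then have "i + 1 \<le> card {v \<in> V. n - i \<le> ?d v}" using chv i by simp
        also have "\<dots> \<le> card {v \<in> V. n - i \<le> degree V ?E v}"
          by (rule card_mono) (use fin d_mono order_trans in auto)
        finally show ?thesis .
      qed
    qed fact+
    moreover have "n \<le> ?d u + ?d w"
    proof (rule ccontr)
      assume "\<not> n \<le> ?d u + ?d w"
      then have sum: "?d u + ?d w < n" by simp
      \<comment> \<open>There are \<open>i + 1\<close> vertices of degree at least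
        \<open>n - i\<close>; \<open>u\<close> is not one of them and has at most \<open>i\<close>
        neighbours.\<close>
      have nonadj: "\<exists>z\<in>V. z \<noteq> u \<and> \<not> E u z \<and> n - i \<le> ?d z"
        if "i + 1 \<le> card {v \<in> V. n - i \<le> ?d v}" "?d u \<le> i" "?d u < n - i" for i
      proof (rule ccontr)
        assume "\<not> ?thesis"
        then have "{v \<in> V. n - i \<le> ?d v} \<subseteq> {v \<in> V. E u v}" using that(3) by auto
        then have "card {v \<in> V. n - i \<le> ?d v} \<le> ?d u"
          unfolding degree_def[of V E u] using fin by (intro card_mono) auto
        then show False using that by simp
      qed
      show False
      proof (cases "?d u = 0")
        case True
        \<comment> \<open>The condition starts at index \<open>1\<close>, so an isolated
          \<open>u\<close> is treated there: it would force a vertex of degree \<open>n - 1\<close>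
          that misses \<open>u\<close>.\<close>
        have "card {u} \<le> card {v \<in> V. ?d v \<le> 1}" by (rule card_mono) (use fin uw True in auto)
        then have "1 + 1 \<le> card {v \<in> V. n - 1 \<le> ?d v}" using chv[of 1] \<open>3 \<le> n\<close> by simp
        then obtain z where z: "z \<in> V" "z \<noteq> u" "\<not> E u z" "n - 1 \<le> ?d z"
          using nonadj[of 1] True \<open>3 \<le> n\<close> by auto
        have "?d z \<le> card (V - {u, z})"
          unfolding degree_def by (rule card_mono) (use fin z E in auto)
        also have "\<dots> = n - 2" using card_Diff_subset[of "{u, z}" V] z uw less.prems(2) by simp
        finally show False using z \<open>3 \<le> n\<close> by simp
      next
        case False
        define i where "i = ?d u"
        have i: "1 \<le> i" "2 * i < n" "?d u < n - i" using False sum uw by (auto simp: i_def)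
        have "{z \<in> V. z \<noteq> w \<and> \<not> E w z} \<union> insert w {z \<in> V. E w z} = V" using uw by auto
        then have "n \<le> card {z \<in> V. z \<noteq> w \<and> \<not> E w z} + card (insert w {z \<in> V. E w z})"
          using card_Un_le less.prems(2) by metis
        also have "card (insert w {z \<in> V. E w z}) = Suc (?d w)"
          using fin E by (simp add: degree_def)
        finally have "i \<le> card {z \<in> V. z \<noteq> w \<and> \<not> E w z}" using sum by (simp add: i_def)
        \<comment> \<open>By maximality of the sum at \<open>u\<close>, \<open>w\<close>, a vertex
          nonadjacent to \<open>w\<close> has degree at most that of \<open>u\<close>.\<close>
        also have "\<dots> \<le> card {v \<in> V. ?d v \<le> i}"
        proof (rule card_mono)
          show "{z \<in> V. z \<noteq> w \<and> \<not> E w z} \<subseteq> {v \<in> V. ?d v \<le> i}"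
            using max_uw[of w] uw by (fastforce simp: i_def)
        qed (use fin in simp)
        finally have "i + 1 \<le> card {v \<in> V. n - i \<le> ?d v}" using chv i by simp
        then obtain z where z: "z \<in> V" "z \<noteq> u" "\<not> E u z" "n - i \<le> ?d z"
          using nonadj[of i] i by (auto simp: i_def)
        then show False using max_uw[of u z] uw sum i by (simp add: i_def)
      qed
    qed
    ultimately show ?thesis
      using hamiltonian_if_add_edge_hamiltonian[OF G uw(1-3) less.prems(2,3)] by blast
  qed
qed

section \<open>Realizations and the extremal graphs\<close>

lemma
  assumes "realization n d V E"
  shows realization_simple_graph: "simple_graph V E"
    and realization_card: "card V = n"
    and realization_mono: "\<And>j k. 1 \<le> j \<Longrightarrow> j \<le> k \<Longrightarrow> k \<le> n \<Longrightarrow> d j \<le> d k"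
  using assms bij_betw_same_card by (fastforce simp: realization_def nondecreasing_seq_def)+

lemma realization_less:
  assumes "realization n d V E" "j \<in> {1..n}"
  shows "d j < n"
proof -
  obtain f where f: "bij_betw f {1..n} V" "\<forall>j\<in>{1..n}. degree V E (f j) = d j"
    using assms(1) unfolding realization_def by blast
  have "finite V" "\<And>x. \<not> E x x"
    using realization_simple_graph[OF assms(1)] by (auto simp: simple_graph_def)
  moreover have "f j \<in> V" using f(1) assms(2) by (auto simp: bij_betw_def)
  ultimately have "degree V E (f j) < card V"
    unfolding degree_def by (intro psubset_card_mono) auto
  then show ?thesis using f(2) assms(2) realization_card[OF assms(1)] by simp
qed

text \<open>If \<open>d i\<close> exceeded \<open>i\<close>, monotonicity would confine the degrees
  up to \<open>i\<close> to the \<open>i - 1\<close> positions before \<open>i\<close>. With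
  \<open>realization_card_ge\<close> this converts the sequence condition into counting
  form.\<close>

lemma realization_le_if_card_le:
  assumes "realization n d V E" "1 \<le> i" "i \<le> n" "i \<le> card {v \<in> V. degree V E v \<le> i}"
  shows "d i \<le> i"
proof (rule ccontr)
  assume "\<not> d i \<le> i"
  obtain f where f: "bij_betw f {1..n} V" "\<forall>j\<in>{1..n}. degree V E (f j) = d j"
    using assms(1) unfolding realization_def by blast
  have "{v \<in> V. degree V E v \<le> i} \<subseteq> f ` {1..<i}"
  proof
    fix v assume v: "v \<in> {v \<in> V. degree V E v \<le> i}"
    then obtain j where j: "j \<in> {1..n}" "v = f j" using f(1) by (auto simp: bij_betw_def)
    then have "d j < d i" using v f(2) \<open>\<not> d i \<le> i\<close> by simp
    then have "j < i" using realization_mono[OF assms(1,2), of j] j by (meson atLeastAtMost_iff not_le)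
    then show "v \<in> f ` {1..<i}" using j by auto
  qed
  then have "card {v \<in> V. degree V E v \<le> i} \<le> card {1..<i}" by (rule surj_card_le[rotated]) simp
  then show False using assms(2,4) by simp
qed

lemma realization_card_ge:
  assumes "realization n d V E" "i < n" "n - i \<le> d (n - i)"
  shows "i + 1 \<le> card {v \<in> V. n - i \<le> degree V E v}"
proof -
  obtain f where f: "bij_betw f {1..n} V" "\<forall>j\<in>{1..n}. degree V E (f j) = d j"
    using assms(1) unfolding realization_def by blast
  have "f ` {n - i..n} \<subseteq> {v \<in> V. n - i \<le> degree V E v}"
  proof
    fix v assume "v \<in> f ` {n - i..n}"
    then obtain j where j: "n - i \<le> j" "j \<le> n" "v = f j" by auto
    moreover have "d (n - i) \<le> d j" using realization_mono[OF assms(1)] j assms(2) by simp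
    ultimately show "v \<in> {v \<in> V. n - i \<le> degree V E v}"
      using f assms(2,3) by (auto simp: bij_betw_def)
  qed
  moreover have "finite V" using realization_simple_graph[OF assms(1)] by (simp add: simple_graph_def)
  ultimately have "card (f ` {n - i..n}) \<le> card {v \<in> V. n - i \<le> degree V E v}" by (intro card_mono) auto
  moreover have "inj_on f {n - i..n}"
    by (rule inj_on_subset[OF bij_betw_imp_inj_on[OF f(1)]]) (use assms(2) in auto)
  ultimately show ?thesis using assms(2) by (simp add: card_image)
qed

theorem realization_pancyclic:
  assumes real: "realization n d V E" and "3 \<le> n"
    and chv: "\<And>i. 1 \<le> i \<Longrightarrow> 2 * i < n \<Longrightarrow> d i \<le> i \<Longrightarrow> n - i \<le> d (n - i)"
    and high: "even n \<Longrightarrow> n div 2 + 1 \<le> d n"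
  shows "pancyclic V E"
proof -
  note G = realization_simple_graph[OF real] and card_V = realization_card[OF real]
  have cond: "i + 1 \<le> card {v \<in> V. n - i \<le> degree V E v}"
    if "1 \<le> i" "2 * i < n" "i \<le> card {v \<in> V. degree V E v \<le> i}" for i
    using realization_card_ge[OF real] realization_le_if_card_le[OF real] chv that by simp
  obtain v where bij: "bij_betw v {..<n} V" and lab: "ham_labelling n (\<lambda>i j. E (v i) (v j))"
    using ham_labelling_if_has_cycle[OF G card_V \<open>3 \<le> n\<close> chvatal_hamiltonian[OF G card_V \<open>3 \<le> n\<close> cond]] .
  interpret ham_labelling n "\<lambda>i j. E (v i) (v j)" by (rule lab)
  have deg: "deg i = degree V E (v i)" if "i < n" for i using degree_relabel[OF bij that] .
  have card_eq: "card {i \<in> {..<n}. P (deg i)} = card {x \<in> V. P (degree V E x)}" for P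
  proof (rule bij_betw_same_card)
    show "bij_betw v {i \<in> {..<n}. P (deg i)} {x \<in> V. P (degree V E x)}"
    proof (rule bij_betw_subset[OF bij])
      show "v ` {i \<in> {..<n}. P (deg i)} = {x \<in> V. P (degree V E x)}"
        using bij deg unfolding bij_betw_def by force
    qed auto
  qed
  have "cyc l" if "3 \<le> l" "l \<le> n" for l
  proof (rule pancyclic_if_chvatal_condition)
    show "i + 1 \<le> card {v \<in> {..<n}. n - i \<le> deg v}"
      if "1 \<le> i" "2 * i < n" "i \<le> card {v \<in> {..<n}. deg v \<le> i}" for i
      using cond[OF that(1,2)] that(3) card_eq[of "\<lambda>x. x \<le> i"] card_eq[of "\<lambda>x. n - i \<le> x"] by simp
    assume "even n"
    obtain f where f: "bij_betw f {1..n} V" "\<forall>j\<in>{1..n}. degree V E (f j) = d j"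
      using real unfolding realization_def by blast
    have "f n \<in> v ` {..<n}" using f(1) bij \<open>3 \<le> n\<close> by (auto simp: bij_betw_def)
    then obtain i where i: "i < n" "v i = f n" by (metis imageE lessThan_iff)
    then have "n div 2 + 1 \<le> deg i" using deg f(2) high \<open>even n\<close> \<open>3 \<le> n\<close> by simp
    then show "\<exists>v<n. n < 2 * deg v" using i(1) by (intro exI[of _ i]) linarith
  qed fact+
  moreover have "has_cycle V E l" if "cyc l" for l
    by (rule has_cycle_map[OF that, of v]) (use bij in \<open>auto simp: bij_betw_def\<close>)
  ultimately show ?thesis using card_V by (simp add: pancyclic_def)
qed

section \<open>The extremal graphs\<close>

lemma degree_join_graph:
  assumes "2 * i < n" "v < n"
  shows "degree {0..<n} (join_graph n i) v = (if v < i then n - 1 else if v < 2 * i then i else n - i - 1)"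
proof -
  consider "v < i" | "i \<le> v" "v < 2 * i" | "2 * i \<le> v" by linarith
  then show ?thesis
  proof cases
    case 1
    then have "{u \<in> {0..<n}. join_graph n i v u} = {0..<n} - {v}"
      using assms by (auto simp: join_graph_def)
    then show ?thesis using 1 assms by (simp add: degree_def)
  next
    case 2
    then have "{u \<in> {0..<n}. join_graph n i v u} = {0..<i}"
      using assms by (auto simp: join_graph_def)
    then show ?thesis using 2 by (simp add: degree_def)
  next
    case 3
    then have "{u \<in> {0..<n}. join_graph n i v u} = ({0..<i} \<union> {2 * i..<n}) - {v}"
      using assms by (auto simp: join_graph_def)
    moreover have "card ({0..<i} \<union> {2 * i..<n}) = n - i"
      using assms by (subst card_Un_disjoint) auto
    ultimately show ?thesis using 3 assms by (simp add: degree_def)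
  qed
qed

lemma realization_join_graph:
  assumes "1 \<le> i" "2 * i < n"
  shows "realization n (\<lambda>j. if j \<le> i then i else if j \<le> n - i then n - i - 1 else n - 1) {0..<n} (join_graph n i)"
  unfolding realization_def
proof (intro conjI exI)
  \<comment> \<open>Lists the vertices by increasing degree: the edgeless part, then the clique on
    \<open>2 * i..<n\<close>, and in the last \<open>i\<close> places the dominating vertices
    \<open>0..<i\<close>.\<close>
  let ?f = "\<lambda>j. if j \<le> n - i then i + j - 1 else j - (n - i) - 1"
  show "simple_graph {0..<n} (join_graph n i)" by (auto simp: simple_graph_def join_graph_def)
  show "nondecreasing_seq n (\<lambda>j. if j \<le> i then i else if j \<le> n - i then n - i - 1 else n - 1)"
    using assms by (auto simp: nondecreasing_seq_def)
  have inj: "inj_on ?f {1..n}" using assms by (auto simp: inj_on_def split: if_splits)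
  have "?f ` {1..n} \<subseteq> {0..<n}" using assms by auto
  moreover have "card (?f ` {1..n}) = card {0..<n}" using card_image[OF inj] by simp
  ultimately have "?f ` {1..n} = {0..<n}" by (intro card_subset_eq) simp_all
  with inj show "bij_betw ?f {1..n} {0..<n}" unfolding bij_betw_def by blast
  show "\<forall>j\<in>{1..n}. degree {0..<n} (join_graph n i) (?f j) =
      (if j \<le> i then i else if j \<le> n - i then n - i - 1 else n - 1)"
    using assms by (auto simp: degree_join_graph)
qed

text \<open>Around an \<open>n\<close>-cycle, both neighbours of each vertex of the edgeless part lie in the part \<open>K\<^sub>i\<close> of
  the same size; hence these two parts alternate and are closed under taking successors.\<close>

lemma join_graph_not_hamiltonian:
  assumes "1 \<le> i" "2 * i < n"
  shows "\<not> has_cycle {0..<n} (join_graph n i) n"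
proof
  assume "has_cycle {0..<n} (join_graph n i) n"
  then obtain xs where xs: "length xs = n" "distinct xs" "set xs \<subseteq> {0..<n}"
    and adj: "\<And>j. j < n \<Longrightarrow> join_graph n i (xs ! j) (xs ! ((j + 1) mod n))"
    unfolding has_cycle_def by blast
  define \<sigma> where "\<sigma> = (\<lambda>j. (j + 1) mod n)"
  have \<sigma>_less: "\<sigma> j < n" for j using assms by (simp add: \<sigma>_def)
  have \<sigma>_inj: "inj_on \<sigma> A" if "A \<subseteq> {..<n}" for A
    unfolding \<sigma>_def by (rule inj_on_subset[OF inj_on_add_mod that])
  have "set xs = {0..<n}"
    by (rule card_subset_eq) (use xs distinct_card[of xs] in auto)
  then have bij: "bij_betw ((!) xs) {..<n} {0..<n}" using bij_betw_nth[OF xs(2)] xs(1) by simp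
  have card_preimage: "card {j \<in> {..<n}. xs ! j \<in> A} = card A" if "A \<subseteq> {0..<n}" for A
  proof (rule bij_betw_same_card)
    show "bij_betw ((!) xs) {j \<in> {..<n}. xs ! j \<in> A} A"
    proof (rule bij_betw_subset[OF bij])
      have "A \<subseteq> (!) xs ` {j \<in> {..<n}. xs ! j \<in> A}"
      proof
        fix a assume "a \<in> A"
        moreover from this have "a \<in> (!) xs ` {..<n}" using bij that by (auto simp: bij_betw_def)
        ultimately show "a \<in> (!) xs ` {j \<in> {..<n}. xs ! j \<in> A}" by auto
      qed
      then show "(!) xs ` {j \<in> {..<n}. xs ! j \<in> A} = A" by auto
    qed auto
  qed
  define P where "P = {j \<in> {..<n}. xs ! j \<in> {0..<i}}"
  define Q where "Q = {j \<in> {..<n}. xs ! j \<in> {i..<2 * i}}"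
  have cards: "card P = i" "card Q = i" unfolding P_def Q_def
    using assms by (subst card_preimage; auto)+
  have fin: "finite P" "finite Q" and sub: "P \<subseteq> {..<n}" "Q \<subseteq> {..<n}" by (auto simp: P_def Q_def)
  have "\<sigma> ` Q \<subseteq> P"
    using adj \<sigma>_less by (fastforce simp: P_def Q_def join_graph_def \<sigma>_def)
  have pred: "j \<in> P" if "j < n" "\<sigma> j \<in> Q" for j
    using adj[OF that(1)] that by (auto simp: P_def Q_def join_graph_def \<sigma>_def)
  have "Q \<subseteq> \<sigma> ` P"
  proof
    fix q assume "q \<in> Q"
    have "\<sigma> ` {..<n} = {..<n}" by (rule endo_inj_surj) (use \<sigma>_less \<sigma>_inj in auto)
    then have "q \<in> \<sigma> ` {..<n}" using \<open>q \<in> Q\<close> sub by blast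
    then obtain j where "j < n" "q = \<sigma> j" by blast
    then show "q \<in> \<sigma> ` P" using pred \<open>q \<in> Q\<close> by blast
  qed
  then have "Q = \<sigma> ` P"
    using fin cards card_image[OF \<sigma>_inj[OF sub(1)]] by (intro card_subset_eq) auto
  then have closed: "\<sigma> j \<in> P \<union> Q" if "j \<in> P \<union> Q" for j using that \<open>\<sigma> ` Q \<subseteq> P\<close> by blast
  obtain j0 where j0: "j0 \<in> Q" using cards assms by fastforce
  have orbit: "(j0 + t) mod n \<in> P \<union> Q" for t
  proof (induction t)
    case 0
    then show ?case using j0 sub by auto
  next
    case (Suc t)
    then show ?case using closed[OF Suc] by (simp add: \<sigma>_def mod_Suc_eq)
  qed
  have "{..<n} \<subseteq> P \<union> Q"
  proof
    fix j assume "j \<in> {..<n}"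
    \<comment> \<open>The orbit of \<open>j0\<close> under the successor map reaches every position,
      whereas \<open>P\<close> and \<open>Q\<close> together have at most \<open>2 * i < n\<close>
      of them.\<close>
    then have "(j0 + (n - j0 + j)) mod n = j" using j0 sub by auto
    then show "j \<in> P \<union> Q" using orbit[of "n - j0 + j"] by simp
  qed
  then have "n \<le> card (P \<union> Q)" using card_mono[of "P \<union> Q" "{..<n}"] fin by simp
  also have "\<dots> \<le> 2 * i" using card_Un_le[of P Q] cards by simp
  finally show False using assms by simp
qed

lemma realization_bip_graph:
  assumes "even n"
  shows "realization n (\<lambda>_. n div 2) {0..<n} (bip_graph n)"
  unfolding realization_def
proof (intro conjI exI)
  show "simple_graph {0..<n} (bip_graph n)" by (auto simp: simple_graph_def bip_graph_def)
  show "nondecreasing_seq n (\<lambda>_. n div 2)" by (simp add: nondecreasing_seq_def)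
  show "bij_betw (\<lambda>j. j - 1) {1..n} {0..<n}"
    by (rule bij_betw_byWitness[where f' = Suc]) auto
  have "degree {0..<n} (bip_graph n) v = n div 2" if "v < n" for v
  proof (cases "v < n div 2")
    case True
    then have "{u \<in> {0..<n}. bip_graph n v u} = {n div 2..<n}" using that by (auto simp: bip_graph_def)
    moreover have "n - n div 2 = n div 2" using assms by presburger
    ultimately show ?thesis by (simp add: degree_def)
  next
    case False
    then have "{u \<in> {0..<n}. bip_graph n v u} = {0..<n div 2}" using that by (auto simp: bip_graph_def)
    then show ?thesis by (simp add: degree_def)
  qed
  then show "\<forall>j\<in>{1..n}. degree {0..<n} (bip_graph n) (j - 1) = n div 2" by auto
qed

lemma bip_graph_no_triangle: "\<not> has_cycle V (bip_graph n) 3"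
proof
  assume "has_cycle V (bip_graph n) 3"
  then obtain xs where "\<And>j. j < 3 \<Longrightarrow> bip_graph n (xs ! j) (xs ! ((j + 1) mod 3))"
    unfolding has_cycle_def by blast
  from this[of 0] this[of 1] this[of 2] show False
    by (auto simp: bip_graph_def numeral_2_eq_2)
qed

theorem theorem3p5p5:
  fixes n :: nat and d :: "nat \<Rightarrow> nat"
  assumes "graphical n d" and "n \<ge> 3"
  shows "((\<forall>i. 1 \<le> i \<and> 2 * i < n \<longrightarrow> d i \<le> i \<longrightarrow> d (n - i) \<ge> n - i)
            \<and> (even n \<longrightarrow> d n \<ge> n div 2 + 1)
          \<longrightarrow> (\<forall>(V :: 'a set) E. realization n d V E \<longrightarrow> pancyclic V E))
    \<and> (\<forall>i. 1 \<le> i \<and> 2 * i < n \<and> d i \<le> i \<and> \<not> d (n - i) \<ge> n - i \<longrightarrow>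
          (\<exists>d'. realization n d' {0..<n} (join_graph n i) \<and> majorizes n d' d)
          \<and> \<not> has_cycle {0..<n} (join_graph n i) n)
    \<and> (even n \<and> \<not> d n \<ge> n div 2 + 1 \<longrightarrow>
          (\<exists>d'. realization n d' {0..<n} (bip_graph n) \<and> majorizes n d' d)
          \<and> \<not> pancyclic {0..<n} (bip_graph n))"
proof (intro conjI impI allI)
  fix V :: "'a set" and E
  assume "(\<forall>i. 1 \<le> i \<and> 2 * i < n \<longrightarrow> d i \<le> i \<longrightarrow> d (n - i) \<ge> n - i) \<and> (even n \<longrightarrow> d n \<ge> n div 2 + 1)"
    and "realization n d V E"
  then show "pancyclic V E" using realization_pancyclic \<open>n \<ge> 3\<close> by blast
next
  obtain W :: "nat set" and F where W: "realization n d W F"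
    using \<open>graphical n d\<close> unfolding graphical_def by blast
  note mono = realization_mono[OF W] and less = realization_less[OF W]
  {
    fix i assume i: "1 \<le> i \<and> 2 * i < n \<and> d i \<le> i \<and> \<not> d (n - i) \<ge> n - i"
    let ?d' = "\<lambda>j. if j \<le> i then i else if j \<le> n - i then n - i - 1 else n - 1"
    \<comment> \<open>The three ranges are bounded by \<open>d i \<le> i\<close>, by
      \<open>d (n - i) < n - i\<close>, and by \<open>d j < n\<close>, which holds in any simple
      graph.\<close>
    have "d j \<le> ?d' j" if "j \<in> {1..n}" for j
      using mono[of j i] mono[of j "n - i"] less[OF that] i that by auto
    then show "\<exists>d'. realization n d' {0..<n} (join_graph n i) \<and> majorizes n d' d"
      using realization_join_graph i unfolding majorizes_def by blast
    show "\<not> has_cycle {0..<n} (join_graph n i) n" using join_graph_not_hamiltonian i by blast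
  }
  {
    assume e: "even n \<and> \<not> d n \<ge> n div 2 + 1"
    have "d j \<le> n div 2" if "j \<in> {1..n}" for j using mono[of j n] e that by auto
    then show "\<exists>d'. realization n d' {0..<n} (bip_graph n) \<and> majorizes n d' d"
      using realization_bip_graph e unfolding majorizes_def by blast
    show "\<not> pancyclic {0..<n} (bip_graph n)"
      using bip_graph_no_triangle \<open>n \<ge> 3\<close> unfolding pancyclic_def by force
  }
qed

end
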